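(* There exist a bounded domain $\Omega\subset\mathbb{R}^2$, a point $x_0\in\Omega$ and a constant $C>0$ such that $$k_\Omega(x,x_0)\le C\,d(x,\partial\Omega)^{-\frac12}\quad\text{for all } x\in\Omega,$$ and a quasiconformal mapping $f:\Omega'\to\Omega$ (a homeomorphism onto $\Omega$), where $\Omega'\subset\mathbb{R}^2$ is a domain, such that $f$ is not uniformly continuous with respect to the Euclidean metric $d(x,y)=|x-y|$ in $\Omega$ and the internal metric $d_I$ in $\Omega'$; that is, $f:(\Omega',d_I)\to(\Omega,|\cdot|)$ is not uniformly continuous.
   Context: A domain is a nonempty open connected set, and $d(x,\partial\Omega)$ is the Euclidean distance from $x$ to the boundary. The quasihyperbolic distance in $\Omega$ is $$k_\Omega(x,x_0)=\inf_{\gamma_x}\int_{\gamma_x}\frac{ds}{d(z,\partial\Omega)},$$ the infimum being taken over all rectifiable curves $\gamma_x$ in $\Omega$ joining $x$ to $x_0$. For a domain $G\subset\mathbb{R}^n$ and $z,w\in G$, the internal distance $d_I(z,w)$ is the infimum of the lengths of all paths that join $z$ to $w$ in $G$. A quasiconformal mapping is a homeomorphism between domains that is $K$-quasiconformal for some $K\ge1$ in the usual sense. *)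

theory Defs
  imports "HOL-Analysis.Analysis"
begin

definition is_domain :: "'a::euclidean_space set \<Rightarrow> bool" where
  "is_domain S \<longleftrightarrow> open S \<and> connected S \<and> S \<noteq> {}"

definition curves_joining :: "'a::euclidean_space set \<Rightarrow> 'a \<Rightarrow> 'a \<Rightarrow> (real \<Rightarrow> 'a) set" where
  "curves_joining S x y =
     {\<gamma>. path \<gamma> \<and> path_image \<gamma> \<subseteq> S \<and> pathstart \<gamma> = x \<and> pathfinish \<gamma> = y}"

text \<open>Length of \<open>\<gamma>\<close> restricted to \<open>[a, b]\<close>: the supremum over partitions of the lengths of
  inscribed polygons, with value \<open>\<infinity>\<close> for non-rectifiable curves.\<close>

definition curve_length :: "(real \<Rightarrow> 'a::metric_space) \<Rightarrow> real \<Rightarrow> real \<Rightarrow> ennreal" where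
  "curve_length \<gamma> a b =
     (SUP (n, t) \<in> {(n::nat, t::nat \<Rightarrow> real). mono_on {..n} t \<and> t ` {..n} \<subseteq> {a..b}}.
        \<Sum>i<n. ennreal (dist (\<gamma> (t i)) (\<gamma> (t (Suc i)))))"

definition rectifiable_curve :: "(real \<Rightarrow> 'a::metric_space) \<Rightarrow> bool" where
  "rectifiable_curve \<gamma> \<longleftrightarrow> curve_length \<gamma> 0 1 < \<infinity>"

text \<open>The next two notions are meant for rectifiable paths only. The arc length parametrization
  \<open>\<gamma>\<^sup>0\<close> is determined by \<open>\<gamma> t = \<gamma>\<^sup>0 (\<ell> t)\<close>, where \<open>\<ell> t\<close> is the length of \<open>\<gamma>\<close> on \<open>[0, t]\<close>; the
  choice of a preimage under \<open>\<ell>\<close> does not matter, as \<open>\<gamma>\<close> is constant wherever \<open>\<ell>\<close> is.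
  The integral of \<open>\<rho>\<close> along \<open>\<gamma>\<close> with respect to arc length is the integral of \<open>\<rho> \<circ> \<gamma>\<^sup>0\<close>.\<close>

definition arclength_param :: "(real \<Rightarrow> 'a::metric_space) \<Rightarrow> real \<Rightarrow> 'a" where
  "arclength_param \<gamma> s = \<gamma> (inv_into {0..1} (\<lambda>t. enn2real (curve_length \<gamma> 0 t)) s)"

definition arclength_integral :: "('a::metric_space \<Rightarrow> ennreal) \<Rightarrow> (real \<Rightarrow> 'a) \<Rightarrow> ennreal" where
  "arclength_integral \<rho> \<gamma> =
     (\<integral>\<^sup>+ s \<in> {0..enn2real (curve_length \<gamma> 0 1)}. \<rho> (arclength_param \<gamma> s) \<partial>lborel)"

text \<open>Only to be used for domains other than the whole space: there the frontier is nonempty and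
  \<open>infdist z (frontier \<Omega>)\<close> is positive on \<open>\<Omega>\<close>.\<close>

definition quasihyperbolic_dist :: "'a::euclidean_space set \<Rightarrow> 'a \<Rightarrow> 'a \<Rightarrow> ennreal" where
  "quasihyperbolic_dist \<Omega> x y =
     (INF \<gamma> \<in> {\<gamma> \<in> curves_joining \<Omega> x y. rectifiable_curve \<gamma>}.
        arclength_integral (\<lambda>z. ennreal (1 / infdist z (frontier \<Omega>))) \<gamma>)"

definition internal_dist :: "'a::euclidean_space set \<Rightarrow> 'a \<Rightarrow> 'a \<Rightarrow> ennreal" where
  "internal_dist G z w = (INF \<gamma> \<in> curves_joining G z w. curve_length \<gamma> 0 1)"

definition uniformly_continuous_internal ::
    "'a::euclidean_space set \<Rightarrow> ('a \<Rightarrow> 'b::metric_space) \<Rightarrow> bool" where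
  "uniformly_continuous_internal G f \<longleftrightarrow>
     (\<forall>\<epsilon>>0. \<exists>\<delta>>0. \<forall>x\<in>G. \<forall>y\<in>G. internal_dist G x y < ennreal \<delta> \<longrightarrow> dist (f x) (f y) < \<epsilon>)"

definition abs_continuous_on_interval ::
    "real \<Rightarrow> real \<Rightarrow> (real \<Rightarrow> 'a::metric_space) \<Rightarrow> bool" where
  "abs_continuous_on_interval a b \<phi> \<longleftrightarrow>
     (\<forall>\<epsilon>>0. \<exists>\<delta>>0. \<forall>(n::nat) (u::nat \<Rightarrow> real) (v::nat \<Rightarrow> real).
        (\<forall>i<n. a \<le> u i \<and> u i \<le> v i \<and> v i \<le> b) \<and>
        disjoint_family_on (\<lambda>i. {u i<..<v i}) {..<n} \<and>
        (\<Sum>i<n. v i - u i) < \<delta> \<longrightarrow>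
        (\<Sum>i<n. dist (\<phi> (u i)) (\<phi> (v i))) < \<epsilon>)"

text \<open>Absolute continuity on lines (ACL): for each closed rectangle in \<open>\<Omega>\<close> with sides parallel to the
  axes, \<open>f\<close> is absolutely continuous on almost every horizontal and almost every vertical
  segment across the rectangle.\<close>

definition abs_continuous_on_lines :: "(real^2) set \<Rightarrow> (real^2 \<Rightarrow> real^2) \<Rightarrow> bool" where
  "abs_continuous_on_lines \<Omega> f \<longleftrightarrow>
     (\<forall>a b. cbox a b \<subseteq> \<Omega> \<and> cbox a b \<noteq> {} \<longrightarrow>
        (AE t in lborel. t \<in> {a$2..b$2} \<longrightarrow>
           abs_continuous_on_interval (a$1) (b$1) (\<lambda>s. f (vector [s, t]))) \<and>
        (AE s in lborel. s \<in> {a$1..b$1} \<longrightarrow>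
           abs_continuous_on_interval (a$2) (b$2) (\<lambda>t. f (vector [s, t]))))"

text \<open>The analytic definition of a (sense-preserving) \<open>K\<close>-quasiconformal mapping of \<open>\<Omega>\<close> onto \<open>\<Omega>'\<close>:
  a homeomorphism of class \<open>W\<^sup>1\<^sup>,\<^sup>2\<close> locally with \<open>|Df|\<^sup>2 \<le> K J\<^sub>f\<close> almost everywhere. For continuous maps,
  \<open>W\<^sup>1\<^sup>,\<^sup>2\<close> locally means ACL with locally square integrable partial derivatives, and a homeomorphism
  that is ACL is differentiable almost everywhere by the Gehring--Lehto theorem, so that \<open>Df\<close> may be
  taken to be the classical derivative.\<close>

definition K_quasiconformal ::
    "real \<Rightarrow> (real^2) set \<Rightarrow> (real^2) set \<Rightarrow> (real^2 \<Rightarrow> real^2) \<Rightarrow> bool" where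
  "K_quasiconformal K \<Omega> \<Omega>' f \<longleftrightarrow>
     is_domain \<Omega> \<and> is_domain \<Omega>' \<and> (\<exists>g. homeomorphism \<Omega> \<Omega>' f g) \<and>
     abs_continuous_on_lines \<Omega> f \<and>
     (\<forall>Q. compact Q \<and> Q \<subseteq> \<Omega> \<longrightarrow>
        (\<lambda>x. (onorm (frechet_derivative f (at x)))\<^sup>2) absolutely_integrable_on Q) \<and>
     (AE x in lebesgue_on \<Omega>. f differentiable (at x) \<and>
        (onorm (frechet_derivative f (at x)))\<^sup>2 \<le> K * det (jacobian f (at x)))"

definition quasiconformal :: "(real^2) set \<Rightarrow> (real^2) set \<Rightarrow> (real^2 \<Rightarrow> real^2) \<Rightarrow> bool" where
  "quasiconformal \<Omega> \<Omega>' f \<longleftrightarrow> (\<exists>K\<ge>1. K_quasiconformal K \<Omega> \<Omega>' f)"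

end

theory Submission
  imports Defs
begin

text \<open>With \<open>h = 2\<^sup>-\<^sup>j\<close>, the domain consists of horizontal layers of length 1 and thickness \<open>h\<^sup>2\<close> accumulating
  at the bottom side of a square, consecutive layers being joined by \<open>2\<^sup>j\<close> equally spaced vertical
  tubes of width \<open>h\<^sup>2\<close> and length about \<open>h\<close>. To climb one level from depth \<open>j\<close> one travels a distance of
  order \<open>h\<close> along a layer and \<open>h\<close> along a tube, always at distance of order \<open>h\<^sup>2\<close> from the boundary; the
  costs \<open>1/h\<close> form a geometric series, so a point of level \<open>j\<close> has quasihyperbolic distance of order
  \<open>1/h\<close> from the top, up to a term that is logarithmic in its distance \<open>d\<close> to the boundary. As \<open>d\<close> is at most of
  order \<open>h\<^sup>2\<close>, the exponent \<open>-1/2\<close> results.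

  Widening each tube in its middle by the factor \<open>1/h\<close> turns it into a channel of width about \<open>h\<close> and
  length comparable to 1, and the \<open>2\<^sup>j\<close> widened channels still fit side by side. If the depth of a layer
  becomes the logarithm of its scale, the layer of level \<open>j\<close>, which has length 1, shrinks
  by a factor that tends to 0. This change of coordinates is quasiconformal, and its
  inverse is not uniformly continuous for the internal metric.\<close>

section \<open>Curves and the quasihyperbolic metric\<close>

lemma curve_length_ge_sum:
  assumes "mono_on {..n} t" "t ` {..n} \<subseteq> {a..b}"
  shows "(\<Sum>i<n. ennreal (dist (\<gamma> (t i)) (\<gamma> (t (Suc i))))) \<le> curve_length \<gamma> a b"
  unfolding curve_length_def using assms by (intro SUP_upper2[of "(n, t)"]) auto

lemma curve_length_leI:
  assumes "\<And>n t. mono_on {..n} t \<Longrightarrow> t ` {..n} \<subseteq> {a..b} \<Longrightarrow>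
     (\<Sum>i<n. ennreal (dist (\<gamma> (t i)) (\<gamma> (t (Suc i))))) \<le> B"
  shows "curve_length \<gamma> a b \<le> B"
  unfolding curve_length_def using assms by (intro SUP_least) auto

lemma curve_length_ge_dist:
  assumes "a \<le> b"
  shows "ennreal (dist (\<gamma> a) (\<gamma> b)) \<le> curve_length \<gamma> a b"
proof -
  have "mono_on {..1::nat} (\<lambda>i. if i = 0 then a else b)"
    using assms by (auto simp: mono_on_def)
  from curve_length_ge_sum[OF this, of a b \<gamma>] show ?thesis using assms by (simp add: image_subset_iff)
qed

lemma curve_length_le_lipschitz:
  assumes "\<And>s t. s \<in> {a..b} \<Longrightarrow> t \<in> {a..b} \<Longrightarrow> dist (\<gamma> s) (\<gamma> t) \<le> L * \<bar>s - t\<bar>"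
    and "L \<ge> 0" "a \<le> b"
  shows "curve_length \<gamma> a b \<le> ennreal (L * (b - a))"
proof (rule curve_length_leI)
  fix n t assume t: "mono_on {..n::nat} t" "t ` {..n} \<subseteq> {a..b}"
  have "(\<Sum>i<n. ennreal (dist (\<gamma> (t i)) (\<gamma> (t (Suc i))))) = ennreal (\<Sum>i<n. dist (\<gamma> (t i)) (\<gamma> (t (Suc i))))"
    by (simp add: sum_ennreal)
  also have "\<dots> \<le> ennreal (\<Sum>i<n. L * (t (Suc i) - t i))"
  proof (intro ennreal_leI sum_mono)
    fix i assume i: "i \<in> {..<n}"
    have "dist (\<gamma> (t i)) (\<gamma> (t (Suc i))) \<le> L * \<bar>t i - t (Suc i)\<bar>"
      using t(2) i by (intro assms(1)) (simp_all add: image_subset_iff)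
    also have "\<bar>t i - t (Suc i)\<bar> = t (Suc i) - t i"
      using t(1) i by (auto simp: mono_on_def)
    finally show "dist (\<gamma> (t i)) (\<gamma> (t (Suc i))) \<le> L * (t (Suc i) - t i)" .
  qed
  also have "(\<Sum>i<n. L * (t (Suc i) - t i)) = L * (t n - t 0)"
    by (simp add: sum_lessThan_telescope flip: sum_distrib_left)
  also have "\<dots> \<le> L * (b - a)"
  proof -
    have "t n \<in> {a..b}" "t 0 \<in> {a..b}" using t(2) by auto
    then show ?thesis using \<open>L \<ge> 0\<close> by (intro mult_left_mono) auto
  qed
  finally show "(\<Sum>i<n. ennreal (dist (\<gamma> (t i)) (\<gamma> (t (Suc i))))) \<le> ennreal (L * (b - a))"
    by (simp add: ennreal_leI)
qed

lemma curve_length_reparam_le: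
  assumes \<phi>: "mono_on {a..b} \<phi>" "\<phi> ` {a..b} \<subseteq> {c..d}"
    and eq: "\<And>s. s \<in> {a..b} \<Longrightarrow> \<eta> s = \<gamma> (\<phi> s)"
  shows "curve_length \<eta> a b \<le> curve_length \<gamma> c d"
proof (rule curve_length_leI)
  fix n t assume t: "mono_on {..n::nat} t" "t ` {..n} \<subseteq> {a..b}"
  have mem: "t i \<in> {a..b}" if "i \<le> n" for i using t(2) that by auto
  have "mono_on {..n} (\<phi> \<circ> t)"
    using t(1) \<phi>(1) mem unfolding mono_on_def by auto
  moreover have "(\<phi> \<circ> t) ` {..n} \<subseteq> {c..d}" using t(2) \<phi>(2) by fastforce
  ultimately have "(\<Sum>i<n. ennreal (dist (\<gamma> ((\<phi> \<circ> t) i)) (\<gamma> ((\<phi> \<circ> t) (Suc i))))) \<le> curve_length \<gamma> c d"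
    by (rule curve_length_ge_sum)
  then show "(\<Sum>i<n. ennreal (dist (\<eta> (t i)) (\<eta> (t (Suc i))))) \<le> curve_length \<gamma> c d"
    using mem by (simp add: eq)
qed

text \<open>A partition of \<open>[a, m]\<close> followed by one of \<open>[m, b]\<close> is a
  partition of \<open>[a, b]\<close> with one more link. This carries the lower length bound in
  \<open>qh_reach\<close> through concatenations.\<close>

lemma curve_length_superadd:
  assumes "a \<le> m" "m \<le> b"
  shows "curve_length \<gamma> a m + curve_length \<gamma> m b \<le> curve_length \<gamma> a b"
proof -
  let ?S = "\<lambda>n t. \<Sum>i<n. ennreal (dist (\<gamma> (t i)) (\<gamma> (t (Suc i))))"
  define P where "P a b = {(n::nat, t::nat \<Rightarrow> real). mono_on {..n} t \<and> t ` {..n} \<subseteq> {a..b}}" for a b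
  have ne: "P a m \<noteq> {}" "P m b \<noteq> {}"
    using assms by (auto simp: P_def intro!: exI[of _ "0::nat"] exI[of _ "\<lambda>_. m"] simp: mono_on_def)
  have key: "?S n t + ?S n' t' \<le> curve_length \<gamma> a b"
    if t: "mono_on {..n} t" "t ` {..n} \<subseteq> {a..m}" and t': "mono_on {..n'} t'" "t' ` {..n'} \<subseteq> {m..b}"
    for n t n' t'
  proof -
    \<comment> \<open>All n + 1 points of \<open>t\<close> come first, hence the shift by
      \<open>Suc n\<close>; the link from \<open>t n\<close> to \<open>t' 0\<close> only adds to the
      sum.\<close>
    define \<tau> where "\<tau> i = (if i \<le> n then t i else t' (i - Suc n))" for i
    have tm: "t i \<in> {a..m}" if "i \<le> n" for i using t(2) that by auto
    have tm': "t' i \<in> {m..b}" if "i \<le> n'" for i using t'(2) that by auto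
    have "mono_on {..Suc n + n'} \<tau>"
    proof (rule mono_onI)
      fix i k assume ik: "i \<in> {..Suc n + n'}" "k \<in> {..Suc n + n'}" "i \<le> k"
      consider "k \<le> n" | "i \<le> n" "k > n" | "i > n" by linarith
      then show "\<tau> i \<le> \<tau> k"
      proof cases
        case 1 then show ?thesis using ik t(1) by (auto simp: \<tau>_def mono_on_def)
      next
        case 2
        have "t i \<le> m" using tm 2 by auto
        also have "m \<le> t' (k - Suc n)" using tm'[of "k - Suc n"] ik 2 by auto
        finally show ?thesis using 2 by (simp add: \<tau>_def)
      next
        case 3
        then have "i - Suc n \<le> k - Suc n" "k - Suc n \<le> n'" using ik by auto
        then show ?thesis using 3 ik t'(1) by (auto simp: \<tau>_def mono_on_def)
      qed
    qed
    moreover have "\<tau> ` {..Suc n + n'} \<subseteq> {a..b}"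
    proof
      fix y assume "y \<in> \<tau> ` {..Suc n + n'}"
      then obtain i where i: "i \<le> Suc n + n'" "y = \<tau> i" by auto
      show "y \<in> {a..b}"
      proof (cases "i \<le> n")
        case True
        then show ?thesis using tm[of i] i assms by (auto simp: \<tau>_def)
      next
        case False
        then have "t' (i - Suc n) \<in> {m..b}" using i by (intro tm') auto
          then show ?thesis using i assms False by (auto simp: \<tau>_def)
      qed
    qed
    ultimately have "?S (Suc n + n') \<tau> \<le> curve_length \<gamma> a b" by (rule curve_length_ge_sum)
    moreover have sum_split: "(\<Sum>i<k + l. F i) = (\<Sum>i<k. F i) + (\<Sum>i<l. F (k + i))" for F :: "nat \<Rightarrow> ennreal" and k l
      by (induction l) (auto simp: add.assoc)
    have "?S (Suc n + n') \<tau> = ?S (Suc n) \<tau> + (\<Sum>i<n'. ennreal (dist (\<gamma> (\<tau> (Suc n + i))) (\<gamma> (\<tau> (Suc (Suc n + i))))))"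
      by (rule sum_split)
    moreover have "?S n t \<le> ?S (Suc n) \<tau>" by (simp add: \<tau>_def)
    moreover have "(\<Sum>i<n'. ennreal (dist (\<gamma> (\<tau> (Suc n + i))) (\<gamma> (\<tau> (Suc (Suc n + i)))))) = ?S n' t'"
      by (simp add: \<tau>_def)
    ultimately show ?thesis by (metis (no_types, lifting) add_right_mono order_trans)
  qed
  define F where "F = (\<lambda>(n, t). ?S n t)"
  have "curve_length \<gamma> a m + curve_length \<gamma> m b = (SUP p\<in>P a m. F p) + (SUP p\<in>P m b. F p)"
    by (simp add: curve_length_def P_def F_def)
  also have "\<dots> = (SUP p\<in>P a m. F p + (SUP p\<in>P m b. F p))"
    by (rule ennreal_SUP_add_left[OF ne(1), symmetric])
  also have "\<dots> = (SUP p\<in>P a m. SUP q\<in>P m b. F p + F q)"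
    by (simp add: ennreal_SUP_add_right[OF ne(2)])
  also have "\<dots> \<le> curve_length \<gamma> a b"
    using key by (intro SUP_least) (auto simp: P_def F_def simp del: sum_ennreal)
  finally show ?thesis .
qed

text \<open>The scaled curve is c-Lipschitz, which bounds its length from above. From below,
  \<gamma> on \<open>[0, c * t]\<close> is the scaled curve reparametrized by s / c.\<close>

lemma curve_length_scale:
  assumes "c \<ge> 0" "t \<ge> 0" "\<And>s. s \<in> {0..c * t} \<Longrightarrow> ennreal s \<le> curve_length \<gamma> 0 s"
    and "\<And>s u. dist (\<gamma> s) (\<gamma> u) \<le> \<bar>s - u\<bar>"
  shows "curve_length (\<lambda>s. \<gamma> (c * s)) 0 t = ennreal (c * t)"
proof (rule antisym)
  show "curve_length (\<lambda>s. \<gamma> (c * s)) 0 t \<le> ennreal (c * t)"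
  proof -
    have "dist (\<gamma> (c * s)) (\<gamma> (c * u)) \<le> c * \<bar>s - u\<bar>" for s u
      using assms(4)[of "c * s" "c * u"] \<open>c \<ge> 0\<close> by (simp add: abs_mult flip: right_diff_distrib)
    then show ?thesis
      using curve_length_le_lipschitz[of 0 t "\<lambda>s. \<gamma> (c * s)" c] assms(1,2) by simp
  qed
  show "ennreal (c * t) \<le> curve_length (\<lambda>s. \<gamma> (c * s)) 0 t"
  proof (cases "c = 0")
    case False
    have "ennreal (c * t) \<le> curve_length \<gamma> 0 (c * t)"
      using assms(1-3) by simp
    also have "\<dots> \<le> curve_length (\<lambda>s. \<gamma> (c * s)) 0 t"
      using assms(1,2) False
      by (intro curve_length_reparam_le[where \<phi> = "\<lambda>s. s / c"])
         (auto simp: mono_on_def divide_right_mono field_simps)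
    finally show ?thesis .
  qed simp
qed

text \<open>The curve \<open>\<gamma>\<close> on \<open>[0, a]\<close> is parametrized by arc length: the length condition only has to be
  a lower bound, because \<open>\<gamma>\<close> is 1-Lipschitz. The Lipschitz condition is imposed on the whole line
  so that \<open>\<gamma>\<close> is Borel measurable.\<close>

definition qh_reach :: "'a::euclidean_space set \<Rightarrow> 'a \<Rightarrow> 'a \<Rightarrow> ennreal \<Rightarrow> bool" where
  "qh_reach \<Omega> x y \<kappa> \<longleftrightarrow>
     (\<exists>a\<ge>0. \<exists>\<gamma>. \<gamma> 0 = x \<and> \<gamma> a = y \<and> \<gamma> ` {0..a} \<subseteq> \<Omega> \<and>
        (\<forall>s t. dist (\<gamma> s) (\<gamma> t) \<le> \<bar>s - t\<bar>) \<and>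
        (\<forall>t\<in>{0..a}. ennreal t \<le> curve_length \<gamma> 0 t) \<and>
        (\<integral>\<^sup>+s\<in>{0..a}. ennreal (1 / infdist (\<gamma> s) (frontier \<Omega>)) \<partial>lborel) \<le> \<kappa>)"

lemma qh_reach_mono: "qh_reach \<Omega> x y \<kappa> \<Longrightarrow> \<kappa> \<le> \<kappa>' \<Longrightarrow> qh_reach \<Omega> x y \<kappa>'"
  unfolding qh_reach_def by (elim exE conjE, intro exI conjI) (auto intro: order_trans)

lemma continuous_on_dist_le:
  fixes \<gamma> :: "real \<Rightarrow> 'a::metric_space"
  assumes "\<And>s t. dist (\<gamma> s) (\<gamma> t) \<le> \<bar>s - t\<bar>"
  shows "continuous_on S \<gamma>"
proof -
  have "1-lipschitz_on S \<gamma>"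
    using assms by (intro lipschitz_onI) (auto simp: dist_real_def)
  then show ?thesis by (rule lipschitz_on_continuous_on)
qed

text \<open>Rescaled to \<open>[0, 1]\<close>, an arc length curve has length function
  \<open>a * t\<close>, so \<open>arclength_param\<close> returns the original curve on
  \<open>[0, a]\<close> and the two integrals agree.\<close>

lemma qh_reach_imp_path_component:
  assumes "qh_reach \<Omega> x y \<kappa>"
  shows "path_component \<Omega> x y" and "quasihyperbolic_dist \<Omega> x y \<le> \<kappa>"
proof -
  from assms obtain a \<gamma> where a: "a \<ge> 0" and \<gamma>: "\<gamma> 0 = x" "\<gamma> a = y" "\<gamma> ` {0..a} \<subseteq> \<Omega>"
    and lip: "\<And>s t. dist (\<gamma> s) (\<gamma> t) \<le> \<bar>s - t\<bar>"
    and len: "\<And>t. t \<in> {0..a} \<Longrightarrow> ennreal t \<le> curve_length \<gamma> 0 t"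
    and int: "(\<integral>\<^sup>+s\<in>{0..a}. ennreal (1 / infdist (\<gamma> s) (frontier \<Omega>)) \<partial>lborel) \<le> \<kappa>"
    unfolding qh_reach_def by blast
  define \<eta> where "\<eta> = (\<lambda>s. \<gamma> (a * s))"
  have am: "a * s \<in> {0..a}" if "s \<in> {0..1}" for s
    using that a by (auto simp: mult_left_le)
  have \<eta>: "\<eta> \<in> curves_joining \<Omega> x y"
    unfolding curves_joining_def path_def path_image_def pathstart_def pathfinish_def
  proof (intro CollectI conjI)
    show "continuous_on {0..1} \<eta>"
      unfolding \<eta>_def
      by (rule continuous_on_compose2[OF continuous_on_dist_le[OF lip, of UNIV]])
         (auto intro!: continuous_intros)
    show "\<eta> ` {0..1} \<subseteq> \<Omega>"
      using am \<gamma>(3) by (fastforce simp: \<eta>_def)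
  qed (simp_all add: \<eta>_def \<gamma>)
  have \<eta>_len: "curve_length \<eta> 0 t = ennreal (a * t)" if "t \<in> {0..1}" for t
    unfolding \<eta>_def using a that
    by (intro curve_length_scale len lip) (auto intro: order_trans[OF _ mult_left_le[of t a]])
  have param: "arclength_param \<eta> s = \<gamma> s" if "s \<in> {0..a}" for s
  proof -
    let ?l = "\<lambda>t. enn2real (curve_length \<eta> 0 t)"
    have l: "?l t = a * t" if "t \<in> {0..1}" for t
      using \<eta>_len[OF that] a that by simp
    have "s \<in> ?l ` {0..1}"
    proof (cases "a = 0")
      case True
      then show ?thesis using that l[of 0] by (auto intro!: image_eqI[of _ _ 0])
    next
      case False
      then have "s / a \<in> {0..1}" using a that by (auto simp: field_simps)
      then show ?thesis using False l[of "s / a"] by (intro image_eqI[of _ _ "s / a"]) auto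
    qed
    \<comment> \<open>The chosen preimage t satisfies a * t = s, and \<eta> t is \<gamma> (a * t);
      this includes a = 0, where \<open>?l\<close> is constant.\<close>
    then have "inv_into {0..1} ?l s \<in> {0..1}" "?l (inv_into {0..1} ?l s) = s"
      by (rule inv_into_into, rule f_inv_into_f)
    then show ?thesis
      using l by (simp add: arclength_param_def \<eta>_def)
  qed
  have "arclength_integral (\<lambda>z. ennreal (1 / infdist z (frontier \<Omega>))) \<eta>
      = (\<integral>\<^sup>+s\<in>{0..a}. ennreal (1 / infdist (\<gamma> s) (frontier \<Omega>)) \<partial>lborel)"
    unfolding arclength_integral_def using \<eta>_len[of 1] a
    by (intro nn_integral_cong) (auto simp: param indicator_def)
  also note int
  finally show "quasihyperbolic_dist \<Omega> x y \<le> \<kappa>"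
    unfolding quasihyperbolic_dist_def
    using \<eta> \<eta>_len[of 1] by (intro INF_lower2[of \<eta>]) (auto simp: rectifiable_curve_def)
  show "path_component \<Omega> x y"
    using \<eta> unfolding path_component_def curves_joining_def by auto
qed

text \<open>Concatenating the two arc length curves gives a curve of the same kind; across the
  junction the Lipschitz bound is the triangle inequality through y.\<close>

lemma qh_reach_trans:
  assumes "qh_reach \<Omega> x y \<kappa>" "qh_reach \<Omega> y z \<mu>"
  shows "qh_reach \<Omega> x z (\<kappa> + \<mu>)"
proof -
  let ?\<rho> = "\<lambda>z. ennreal (1 / infdist z (frontier \<Omega>))"
  from assms(1) obtain a \<gamma> where a: "a \<ge> 0" and \<gamma>: "\<gamma> 0 = x" "\<gamma> a = y" "\<gamma> ` {0..a} \<subseteq> \<Omega>"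
    and lip: "\<And>s t. dist (\<gamma> s) (\<gamma> t) \<le> \<bar>s - t\<bar>"
    and len: "\<And>t. t \<in> {0..a} \<Longrightarrow> ennreal t \<le> curve_length \<gamma> 0 t"
    and int: "(\<integral>\<^sup>+s\<in>{0..a}. ?\<rho> (\<gamma> s) \<partial>lborel) \<le> \<kappa>"
    unfolding qh_reach_def by blast
  from assms(2) obtain b \<eta> where b: "b \<ge> 0" and \<eta>: "\<eta> 0 = y" "\<eta> b = z" "\<eta> ` {0..b} \<subseteq> \<Omega>"
    and lip': "\<And>s t. dist (\<eta> s) (\<eta> t) \<le> \<bar>s - t\<bar>"
    and len': "\<And>t. t \<in> {0..b} \<Longrightarrow> ennreal t \<le> curve_length \<eta> 0 t"
    and int': "(\<integral>\<^sup>+s\<in>{0..b}. ?\<rho> (\<eta> s) \<partial>lborel) \<le> \<mu>"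
    unfolding qh_reach_def by blast
  define \<zeta> where "\<zeta> s = (if s \<le> a then \<gamma> s else \<eta> (s - a))" for s
  have \<zeta>_lip_aux: "dist (\<zeta> s) (\<zeta> t) \<le> \<bar>s - t\<bar>" if "s \<le> t" for s t
  proof -
    consider "t \<le> a" | "s \<le> a" "t > a" | "s > a" using that by linarith
    then show ?thesis
    proof cases
      case 2
      have "dist (\<gamma> s) (\<eta> (t - a)) \<le> dist (\<gamma> s) (\<gamma> a) + dist (\<eta> 0) (\<eta> (t - a))"
        using \<gamma>(2) \<eta>(1) dist_triangle by metis
      also have "\<dots> \<le> \<bar>s - a\<bar> + \<bar>0 - (t - a)\<bar>" by (intro add_mono lip lip')
      finally show ?thesis using 2 by (simp add: \<zeta>_def)
    qed (use that lip[of s t] lip'[of "s - a" "t - a"] in \<open>auto simp: \<zeta>_def\<close>)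
  qed
  have \<zeta>_lip: "dist (\<zeta> s) (\<zeta> t) \<le> \<bar>s - t\<bar>" for s t
    using \<zeta>_lip_aux[of s t] \<zeta>_lip_aux[of t s] by (cases "s \<le> t") (auto simp: dist_commute)
  have \<zeta>_\<eta>: "\<zeta> s = \<eta> (s - a)" if "s \<ge> a" for s
    using that \<gamma>(2) \<eta>(1) by (auto simp: \<zeta>_def)
  have \<zeta>_len: "ennreal t \<le> curve_length \<zeta> 0 t" if t: "t \<in> {0..a+b}" for t
  proof (cases "t \<le> a")
    case True
    have "ennreal t \<le> curve_length \<gamma> 0 t" using len[of t] t True by auto
    also have "\<dots> \<le> curve_length \<zeta> 0 t"
      using True by (intro curve_length_reparam_le[of _ _ id]) (auto simp: mono_on_def \<zeta>_def)
    finally show ?thesis .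
  next
    case False
    have "ennreal t = ennreal a + ennreal (t - a)"
      using a False by (simp flip: ennreal_plus)
    also have "ennreal a \<le> curve_length \<gamma> 0 a" using len[of a] a by simp
    also have "\<dots> \<le> curve_length \<zeta> 0 a"
      by (intro curve_length_reparam_le[of _ _ id]) (auto simp: mono_on_def \<zeta>_def)
    also have "ennreal (t - a) \<le> curve_length \<eta> 0 (t - a)" using len'[of "t - a"] False t by simp
    also have "\<dots> \<le> curve_length \<zeta> a t"
      by (intro curve_length_reparam_le[of _ _ "\<lambda>s. s + a"]) (auto simp: mono_on_def \<zeta>_\<eta>)
    also have "curve_length \<zeta> 0 a + curve_length \<zeta> a t \<le> curve_length \<zeta> 0 t"
      using a False by (intro curve_length_superadd) auto
    finally show ?thesis by (simp add: add_mono)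
  qed
  have \<zeta>_img: "\<zeta> ` {0..a+b} \<subseteq> \<Omega>"
  proof
    fix w assume "w \<in> \<zeta> ` {0..a+b}"
    then obtain s where s: "s \<in> {0..a+b}" "w = \<zeta> s" by auto
    show "w \<in> \<Omega>"
    proof (cases "s \<le> a")
      case True
      then show ?thesis using s \<gamma>(3) by (auto simp: \<zeta>_def)
    next
      case False
      then have "\<eta> (s - a) \<in> \<eta> ` {0..b}" using s by auto
      then show ?thesis using s \<eta>(3) False by (auto simp: \<zeta>_def)
    qed
  qed
  have meas: "(\<lambda>s. ?\<rho> (\<theta> s)) \<in> borel_measurable borel" if "\<And>s t. dist (\<theta> s) (\<theta> t) \<le> \<bar>s - t\<bar>" for \<theta> :: "real \<Rightarrow> 'a"
  proof -
    have [measurable]: "\<theta> \<in> borel_measurable borel"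
      using continuous_on_dist_le[OF that] by (rule borel_measurable_continuous_onI)
    have [measurable]: "(\<lambda>z. infdist z (frontier \<Omega>)) \<in> borel_measurable borel"
      by (rule borel_measurable_continuous_onI) (intro continuous_intros)
    show ?thesis by measurable
  qed
  \<comment> \<open>The junction a is counted in both terms on the right, which an inequality
    allows.\<close>
  have "(\<integral>\<^sup>+s\<in>{0..a+b}. ?\<rho> (\<zeta> s) \<partial>lborel)
      \<le> (\<integral>\<^sup>+s. ?\<rho> (\<gamma> s) * indicator {0..a} s + ?\<rho> (\<zeta> s) * indicator {a..a+b} s \<partial>lborel)"
    by (intro nn_integral_mono) (auto simp: indicator_def \<zeta>_def)
  also have "\<dots> = (\<integral>\<^sup>+s\<in>{0..a}. ?\<rho> (\<gamma> s) \<partial>lborel) + (\<integral>\<^sup>+s\<in>{a..a+b}. ?\<rho> (\<zeta> s) \<partial>lborel)"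
    using meas[OF lip] meas[OF \<zeta>_lip] by (intro nn_integral_add) auto
  also have "(\<integral>\<^sup>+s\<in>{a..a+b}. ?\<rho> (\<zeta> s) \<partial>lborel) = (\<integral>\<^sup>+s\<in>{0..b}. ?\<rho> (\<eta> s) \<partial>lborel)"
    using meas[OF \<zeta>_lip] 
    by (subst nn_integral_real_affine[where c = 1 and t = a])
       (auto intro!: nn_integral_cong simp: indicator_def \<zeta>_\<eta>)
  also have "(\<integral>\<^sup>+s\<in>{0..a}. ?\<rho> (\<gamma> s) \<partial>lborel) + \<dots> \<le> \<kappa> + \<mu>"
    by (intro add_mono int int')
  finally have "(\<integral>\<^sup>+s\<in>{0..a+b}. ?\<rho> (\<zeta> s) \<partial>lborel) \<le> \<kappa> + \<mu>" .
  then show ?thesis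
    unfolding qh_reach_def
    using a b \<zeta>_len \<zeta>_lip \<zeta>_img \<gamma>(1) \<eta>(2) \<zeta>_\<eta>[of "a+b"]
    by (intro exI[of _ "a+b"] exI[of _ \<zeta>] conjI) (simp_all add: \<zeta>_def[of 0])
qed

section \<open>Segments and the distance to the boundary\<close>

lemma sgn_segment_mem:
  fixes x y :: "'a::euclidean_space"
  assumes "s \<in> {0..dist x y}"
  shows "x + s *\<^sub>R sgn (y - x) \<in> closed_segment x y"
proof (cases "x = y")
  case False
  then have "x + s *\<^sub>R sgn (y - x) = (1 - s / dist x y) *\<^sub>R x + (s / dist x y) *\<^sub>R y"
    by (simp add: sgn_div_norm dist_norm norm_minus_commute algebra_simps divide_inverse)
  then show ?thesis using False assms unfolding closed_segment_def
    by (auto intro!: exI[of _ "s / dist x y"])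
qed simp

lemma qh_reach_segment:
  fixes x y :: "'a::euclidean_space"
  assumes "closed_segment x y \<subseteq> \<Omega>"
  shows "qh_reach \<Omega> x y
    (\<integral>\<^sup>+s\<in>{0..dist x y}. ennreal (1 / infdist (x + s *\<^sub>R sgn (y - x)) (frontier \<Omega>)) \<partial>lborel)"
proof -
  \<comment> \<open>\<open>sgn (y - x)\<close> is the unit vector from x towards y, so s is arc
    length; for x = y it is 0 and the parameter interval is a point.\<close>
  define \<gamma> where "\<gamma> s = x + s *\<^sub>R sgn (y - x)" for s
  have end1: "\<gamma> (dist x y) = y"
    by (cases "x = y") (simp_all add: \<gamma>_def sgn_div_norm dist_norm norm_minus_commute)
  have diff: "dist (\<gamma> s) (\<gamma> t) = \<bar>s - t\<bar> * norm (sgn (y - x))" for s t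
    by (simp add: \<gamma>_def dist_norm flip: scaleR_diff_left)
  have lip: "dist (\<gamma> s) (\<gamma> t) \<le> \<bar>s - t\<bar>" for s t
    unfolding diff by (simp add: norm_sgn)
  have len: "ennreal t \<le> curve_length \<gamma> 0 t" if "t \<in> {0..dist x y}" for t
  proof (cases "x = y")
    case True
    then show ?thesis using that by simp
  next
    case False
    then have "ennreal t = ennreal (dist (\<gamma> 0) (\<gamma> t))"
      using that unfolding diff by (simp add: norm_sgn)
    then show ?thesis using curve_length_ge_dist[of 0 t \<gamma>] that by simp
  qed
  have "\<gamma> s \<in> closed_segment x y" if "s \<in> {0..dist x y}" for s
    unfolding \<gamma>_def by (rule sgn_segment_mem[OF that])
  then show ?thesis
    unfolding qh_reach_def using assms end1 lip len
    by (intro exI[of _ "dist x y"] exI[of _ \<gamma>] conjI) (auto simp: \<gamma>_def)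
qed

text \<open>Frontier points of an open set lie outside it, hence outside the ball. The frontier has
  to be nonempty because \<open>infdist\<close> to the empty set is 0.\<close>

lemma infdist_frontier_ge:
  fixes z :: "'a::euclidean_space"
  assumes "ball z \<delta> \<subseteq> \<Omega>" "open \<Omega>" "frontier \<Omega> \<noteq> {}"
  shows "\<delta> \<le> infdist z (frontier \<Omega>)"
proof -
  have "\<delta> \<le> dist z w" if "w \<in> frontier \<Omega>" for w
    using that assms(1,2) by (force simp: frontier_def interior_open mem_ball not_le)
  then show ?thesis
    using assms(3) by (auto simp: infdist_def intro!: cINF_greatest)
qed

text \<open>The segment from a point inside to a point outside meets the frontier.\<close>

lemma infdist_frontier_le:
  fixes z :: "'a::euclidean_space"
  assumes "z \<in> \<Omega>" "w \<notin> \<Omega>"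
  shows "infdist z (frontier \<Omega>) \<le> dist z w"
proof -
  have "closed_segment z w \<inter> frontier \<Omega> \<noteq> {}"
    using assms by (intro connected_Int_frontier) auto
  then obtain v where "v \<in> closed_segment z w" "v \<in> frontier \<Omega>" by blast
  then have "infdist z (frontier \<Omega>) \<le> dist z v" by (intro infdist_le)
  also have "\<dots> \<le> dist z w"
    using dist_in_closed_segment[OF \<open>v \<in> closed_segment z w\<close>] by (simp add: dist_commute)
  finally show ?thesis .
qed

lemma qh_reach_segment_ball:
  fixes x y :: "'a::euclidean_space"
  assumes "\<And>z. z \<in> closed_segment x y \<Longrightarrow> ball z \<delta> \<subseteq> \<Omega>" "\<delta> > 0" "open \<Omega>" "frontier \<Omega> \<noteq> {}"
  shows "qh_reach \<Omega> x y (ennreal (dist x y / \<delta>))"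
proof -
  have seg: "closed_segment x y \<subseteq> \<Omega>" using assms(1,2) by force
  have "\<delta> \<le> infdist (x + s *\<^sub>R sgn (y - x)) (frontier \<Omega>)" if "s \<in> {0..dist x y}" for s
    using assms by (intro infdist_frontier_ge) (rule assms(1)[OF sgn_segment_mem[OF that]])
  then have "(\<integral>\<^sup>+s\<in>{0..dist x y}. ennreal (1 / infdist (x + s *\<^sub>R sgn (y - x)) (frontier \<Omega>)) \<partial>lborel)
    \<le> (\<integral>\<^sup>+s\<in>{0..dist x y}. ennreal (1 / \<delta>) \<partial>lborel)"
    using assms(2) by (intro nn_integral_mono) (auto simp: indicator_def intro!: ennreal_leI divide_left_mono mult_pos_pos intro: less_le_trans)
  also have "\<dots> = ennreal (dist x y / \<delta>)"
    using assms(2) by (subst nn_integral_cmult_indicator) (auto simp: ennreal_mult'[symmetric])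
  finally show ?thesis by (rule qh_reach_mono[OF qh_reach_segment[OF seg]])
qed

text \<open>Turns a logarithmic cost into the power d^(-1/2): the quotient is at most the square of
  1 + 1 / sqrt d, and ln (1 + t) <= t.\<close>

lemma ln_quotient_le:
  fixes d :: real
  assumes "d > 0" "0 \<le> L" "L \<le> 1"
  shows "ln ((d + L) / d) \<le> 2 / sqrt d"
proof -
  have "(d + L) / d \<le> 1 + 1 / d" using assms by (simp add: field_simps)
  also have "\<dots> \<le> (1 + 1 / sqrt d)\<^sup>2"
    using assms by (simp add: power2_sum power_divide)
  finally have "ln ((d + L) / d) \<le> ln ((1 + 1 / sqrt d)\<^sup>2)"
    using assms by (intro ln_mono) (auto intro!: divide_pos_pos add_pos_nonneg)
  also have "\<dots> = 2 * ln (1 + 1 / sqrt d)"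
    using assms by (simp add: ln_realpow add_pos_nonneg)
  also have "\<dots> \<le> 2 * (1 / sqrt d)"
    using assms by (intro mult_left_mono ln_add_one_self_le_self) auto
  finally show ?thesis by simp
qed

text \<open>The distance to the boundary at the point of the segment at distance \<open>s\<close> from \<open>x\<close> is at least
  \<open>d - s\<close> and at least \<open>s / 2\<close>, hence at least \<open>(d + s) / 5\<close>. This makes the quasihyperbolic length
  logarithmic in \<open>d\<close>.\<close>

lemma qh_reach_convex_center:
  fixes x y :: "'a::euclidean_space"
  assumes S: "convex S" "x \<in> S" "ball y r \<subseteq> S" "S \<subseteq> \<Omega>"
    and \<Omega>: "open \<Omega>" "frontier \<Omega> \<noteq> {}"
    and r: "dist x y \<le> 2 * r" "r > 0" "dist x y \<le> 1"
  shows "qh_reach \<Omega> x y (ennreal (10 / sqrt (infdist x (frontier \<Omega>))))"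
proof -
  define d where "d = infdist x (frontier \<Omega>)"
  have "closed (frontier \<Omega>)" by simp
  moreover have "x \<notin> frontier \<Omega>" using S(2,4) \<Omega>(1) by (auto simp: frontier_def interior_open)
  ultimately have d: "d > 0" unfolding d_def
    using \<Omega>(2) infdist_nonneg[of x "frontier \<Omega>"] in_closed_iff_infdist_zero[of "frontier \<Omega>" x] by linarith
  define L where "L = dist x y"
  have L: "0 \<le> L" "L \<le> 1" "L \<le> 2 * r" using r by (auto simp: L_def)
  define z where "z s = x + s *\<^sub>R sgn (y - x)" for s
  have "y \<in> S" using S(3) r(2) by auto
  then have seg: "closed_segment x y \<subseteq> \<Omega>" using S(1,2,4) closed_segment_subset by blast
  have bound: "(d + s) / 5 \<le> infdist (z s) (frontier \<Omega>)" if s: "s \<in> {0..L}" for s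
  proof -
    have "d \<le> infdist (z s) (frontier \<Omega>) + dist x (z s)"
      unfolding d_def by (rule infdist_triangle)
    also have "dist x (z s) \<le> s"
      using s by (simp add: z_def dist_norm norm_sgn)
    finally have 1: "d - s \<le> infdist (z s) (frontier \<Omega>)" by simp
    have 2: "s / 2 \<le> infdist (z s) (frontier \<Omega>)"
    proof (rule infdist_frontier_ge[OF _ \<Omega>])
      show "ball (z s) (s / 2) \<subseteq> \<Omega>"
      proof (cases "s = 0")
        case False
        then have s0: "s > 0" "L > 0" using s by auto
        \<comment> \<open>The homothety with centre x and ratio t maps the ball about y of radius r
          onto the ball about \<open>z s\<close> of radius t * r, which is at least s / 2 since L <=
          2 * r. By convexity the image stays in S.\<close>
        define t where "t = s / L"
        have t: "0 < t" "t \<le> 1" using s s0 by (auto simp: t_def)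
        have zt: "z s = (1 - t) *\<^sub>R x + t *\<^sub>R y"
          by (simp add: z_def t_def L_def sgn_div_norm dist_norm norm_minus_commute algebra_simps divide_inverse)
        have "w \<in> S" if w: "w \<in> ball (z s) (s / 2)" for w
        proof -
          define v where "v = y + (1 / t) *\<^sub>R (w - z s)"
          have "norm ((1 / t) *\<^sub>R (w - z s)) = dist (z s) w * (L / s)"
            using t s0 by (simp add: t_def dist_norm norm_minus_commute)
          also have "\<dots> < s / 2 * (L / s)" using w s0 by (intro mult_strict_right_mono) auto
          also have "\<dots> \<le> r" using s0 L by simp
          finally have "v \<in> S" using S(3) by (auto simp: v_def dist_norm)
          moreover have "w = (1 - t) *\<^sub>R x + t *\<^sub>R v"
            using t by (simp add: v_def zt algebra_simps)
          ultimately show "w \<in> S" using S(1,2) t by (simp add: convexD)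
        qed
        then show ?thesis using S(4) by auto
      qed simp
    qed
    \<comment> \<open>Weight 1/5 on the first bound and 4/5 on the second.\<close>
    show ?thesis using 1 2 s by (simp add: field_simps)
  qed
  have "(\<integral>\<^sup>+s\<in>{0..L}. ennreal (1 / infdist (z s) (frontier \<Omega>)) \<partial>lborel)
      \<le> (\<integral>\<^sup>+s. ennreal (5 / (d + s)) * indicator {0..L} s \<partial>lborel)"
  proof (intro nn_integral_mono)
    fix s
    show "ennreal (1 / infdist (z s) (frontier \<Omega>)) * indicator {0..L} s \<le> ennreal (5 / (d + s)) * indicator {0..L} s"
    proof (cases "s \<in> {0..L}")
      case True
      then have "1 / infdist (z s) (frontier \<Omega>) \<le> 1 / ((d + s) / 5)"
        using bound[OF True] d by (intro divide_left_mono mult_pos_pos) auto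
      then show ?thesis using True by (simp add: ennreal_leI)
    qed simp
  qed
  also have "\<dots> = ennreal (5 * ln (d + L) - 5 * ln (d + 0))"
  proof (intro nn_integral_FTC_Icc)
    show "((\<lambda>s. 5 * ln (d + s)) has_real_derivative 5 / (d + s)) (at s)"
      if "s \<in> {0..L}" for s
      using that d by (auto intro!: derivative_eq_intros)
  qed (use d L in auto)
  also have "5 * ln (d + L) - 5 * ln (d + 0) = 5 * ln ((d + L) / d)"
    using d L by (simp add: ln_div)
  also have "\<dots> \<le> 10 / sqrt d" using ln_quotient_le[OF d L(1,2)] by simp
  finally show ?thesis
    unfolding d_def z_def L_def
    by (intro qh_reach_mono[OF qh_reach_segment[OF seg]]) (simp add: ennreal_leI)
qed

section \<open>The domain\<close>

text \<open>The box shrunk by \<delta> on all sides is convex, so it contains the segment along with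
  its end points.\<close>

lemma ball_subset_box_if_segment:
  fixes a b :: "real^'n"
  assumes "\<And>i. a$i + \<delta> \<le> x$i \<and> x$i + \<delta> \<le> b$i" "\<And>i. a$i + \<delta> \<le> y$i \<and> y$i + \<delta> \<le> b$i"
    and "z \<in> closed_segment x y"
  shows "ball z \<delta> \<subseteq> box a b"
proof
  let ?C = "cbox (\<chi> i. a$i + \<delta>) (\<chi> i. b$i - \<delta>)"
  fix w assume w: "w \<in> ball z \<delta>"
  have "x \<in> ?C" "y \<in> ?C" using assms(1,2) by (auto simp: mem_box_cart algebra_simps)
  then have "z \<in> ?C" using assms(3) closed_segment_subset[of x ?C y] by auto
  then have z: "a$i + \<delta> \<le> z$i \<and> z$i \<le> b$i - \<delta>" for i by (auto simp: mem_box_cart)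
  have "a$i < w$i \<and> w$i < b$i" for i
    using component_le_norm_cart[of "z - w" i] w z[of i] by (auto simp: dist_norm)
  then show "w \<in> box a b" by (simp add: mem_box_cart)
qed

section \<open>Layers, tubes and dyadic levels\<close>

definition layer :: "real \<Rightarrow> (real^2) set" where
  "layer h = box (vector [0, 2 * h - h\<^sup>2]) (vector [1, 2 * h])"

text \<open>With h' = h / 2, the lower end h - h^2 / 4 equals 2 h' - h'^2, the bottom of the next
  layer.\<close>

definition tube :: "real \<Rightarrow> real \<Rightarrow> (real^2) set" where
  "tube h c = box (vector [c - h\<^sup>2 / 2, h - h\<^sup>2 / 4]) (vector [c + h\<^sup>2 / 2, 2 * h])"

definition level :: "nat \<Rightarrow> real" where
  "level j = (1/2) ^ j"

definition centre :: "real \<Rightarrow> nat \<Rightarrow> real" where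
  "centre h i = h * (real i + 1/2)"

text \<open>The tube of level \<open>j\<close> joins the layers of levels \<open>j\<close> and \<open>j + 1\<close> and runs through the full
  height of both of them.\<close>

definition tower :: "(real^2) set" where
  "tower = (\<Union>j\<in>{1..}. layer (level j) \<union> (\<Union>i<2^j. tube (level j) (centre (level j) i)))"

lemma mem_layer: "p \<in> layer h \<longleftrightarrow> 0 < p$1 \<and> p$1 < 1 \<and> 2 * h - h\<^sup>2 < p$2 \<and> p$2 < 2 * h"
  by (auto simp: layer_def mem_box_cart forall_2)

lemma mem_tube:
  "p \<in> tube h c \<longleftrightarrow> \<bar>p$1 - c\<bar> < h\<^sup>2 / 2 \<and> h - h\<^sup>2 / 4 < p$2 \<and> p$2 < 2 * h"
  unfolding tube_def mem_box_cart forall_2 vector_2 abs_less_iff by argo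

lemma level_bounds:
  assumes "j \<ge> 1"
  shows "0 < level j" "level j \<le> 1/2"
  using power_decreasing[of 1 j "1/2::real"] assms by (auto simp: level_def)

lemma level_Suc: "level j = 2 * level (Suc j)"
  by (simp add: level_def)

lemma level_less: "j < k \<Longrightarrow> 2 * level k \<le> level j"
  using power_decreasing[of "Suc j" k "1/2::real"] by (simp add: level_def)

lemma level_square:
  assumes "j \<ge> 1"
  shows "(level j)\<^sup>2 > 0" "(level j)\<^sup>2 \<le> level j / 2" 
  using level_bounds[OF assms] mult_left_mono[of "level j" "1/2" "level j"]
  by (auto simp: power2_eq_square)

lemma layer_subset_tower: "j \<ge> 1 \<Longrightarrow> layer (level j) \<subseteq> tower"
  by (auto simp: tower_def)

lemma tube_subset_tower: "j \<ge> 1 \<Longrightarrow> i < 2^j \<Longrightarrow> tube (level j) (centre (level j) i) \<subseteq> tower"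
  unfolding tower_def by blast

lemma centre_bounds:
  assumes "i < 2^j"
  shows "level j / 2 \<le> centre (level j) i" "centre (level j) i \<le> 1 - level j / 2"
proof -
  have "real i + 1 \<le> 2^j" using assms by (metis Suc_leI of_nat_Suc of_nat_le_iff of_nat_numeral of_nat_power add.commute)
  then have "level j * (real i + 1) \<le> level j * 2^j" by (intro mult_left_mono) (auto simp: level_def)
  also have "\<dots> = 1" by (simp add: level_def power_divide)
  finally show "centre (level j) i \<le> 1 - level j / 2" by (simp add: centre_def algebra_simps)
  show "level j / 2 \<le> centre (level j) i" by (simp add: centre_def level_def)
qed

lemma ex_centre_near:
  assumes "0 \<le> x" "x < 1"
  obtains i where "i < 2^j" "\<bar>x - centre (level j) i\<bar> \<le> level j / 2"
proof
  define i where "i = nat \<lfloor>x * 2^j\<rfloor>"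
  have i: "real i = of_int \<lfloor>x * 2^j\<rfloor>" using assms by (simp add: i_def)
  have "real i \<le> x * 2^j" unfolding i by (rule of_int_floor_le)
  also have "\<dots> < real (2^j)" using assms by simp
  finally have "real i < real (2^j)" .
  then show "i < 2^j" by (simp only: of_nat_less_iff)
  have "\<bar>x * 2^j - (real i + 1/2)\<bar> \<le> 1/2" unfolding i by linarith
  then have "level j * \<bar>x * 2^j - (real i + 1/2)\<bar> \<le> level j * (1/2)"
    by (intro mult_left_mono) (auto simp: level_def)
  moreover have "level j * \<bar>x * 2^j - (real i + 1/2)\<bar> = \<bar>level j * (x * 2^j - (real i + 1/2))\<bar>"
    by (simp add: abs_mult level_def)
  moreover have "level j * (x * 2^j - (real i + 1/2)) = x - centre (level j) i"
    by (simp add: centre_def level_def power_divide algebra_simps)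
  ultimately show "\<bar>x - centre (level j) i\<bar> \<le> level j / 2" by simp
qed

section \<open>Horizontal sections of the tower\<close>

lemma tower_cases:
  assumes "p \<in> tower"
  obtains (layer) j where "j \<ge> 1" "p \<in> layer (level j)"
  | (tube) j i where "j \<ge> 1" "i < 2^j" "p \<in> tube (level j) (centre (level j) i)"
  using assms unfolding tower_def by auto

text \<open>At these heights only tubes of level j remain: deeper pieces lie below 2 * level k <=
  level j, and a piece of level k < j lies above the lower end of its tubes, which is no lower than
  the bottom of layer j.\<close>

lemma tower_gap:
  assumes j: "j \<ge> 1" and y: "level j \<le> p$2" "p$2 \<le> 2 * level j - (level j)\<^sup>2" and p: "p \<in> tower"
  obtains i where "i < 2^j" "\<bar>p$1 - centre (level j) i\<bar> < (level j)\<^sup>2 / 2"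
proof -
  let ?h = "level j"
  have below: "2 * level k \<le> ?h" if "k > j" for k using level_less[OF that] .
  have above: "2 * ?h - ?h\<^sup>2 \<le> level k - (level k)\<^sup>2 / 4" if "k < j" "k \<ge> 1" for k
  proof -
    have "2 * ?h \<le> level k" "level k \<le> 1/2" "0 < ?h"
      using level_less[OF that(1)] level_bounds[OF that(2)] level_bounds[OF j] by auto
    \<comment> \<open>For level k = 2 * ?h both sides of the claim are equal, so their difference
      has the factor level k - 2 * ?h.\<close>
    then have "0 \<le> (level k - 2 * ?h) * (1 - (level k + 2 * ?h) / 4)"
      by (intro mult_nonneg_nonneg) auto
    also have "\<dots> = level k - (level k)\<^sup>2 / 4 - (2 * ?h - ?h\<^sup>2)"
      by (simp add: field_simps power2_eq_square)
    finally show ?thesis by simp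
  qed
  from p show thesis
  proof (cases rule: tower_cases)
    case (layer k)
    consider "k = j" | "k < j" | "k > j" by linarith
    then show thesis
    proof cases
      case 2
      have "level k - (level k)\<^sup>2 / 4 \<le> 2 * level k - (level k)\<^sup>2"
        using level_square[OF layer(1)] level_bounds[OF layer(1)] by linarith
      then show thesis using above[OF 2 layer(1)] layer(2) y by (simp add: mem_layer)
    qed (use layer(2) y below in \<open>force simp: mem_layer\<close>)+
  next
    case (tube k i)
    consider "k = j" | "k < j" | "k > j" by linarith
    then show thesis
    proof cases
      case 1
      then show thesis using tube that by (auto simp: mem_tube)
    next
      case 2
      then show thesis using above[OF 2 tube(1)] tube(3) y by (simp add: mem_tube)
    next
      case 3
      then show thesis using below[OF 3] tube(3) y by (simp add: mem_tube)
    qed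
  qed
qed

lemma centre_diff: "\<bar>centre h i - centre h k\<bar> < h \<Longrightarrow> h > 0 \<Longrightarrow> i = k"
proof -
  assume a: "\<bar>centre h i - centre h k\<bar> < h" "h > 0"
  have "centre h i - centre h k = h * (real i - real k)" by (simp add: centre_def algebra_simps)
  then have "h * \<bar>real i - real k\<bar> < h * 1" using a by (simp add: abs_mult)
  then have "\<bar>real i - real k\<bar> < 1" using a(2) mult_less_cancel_left_pos by blast
  then show "i = k" by linarith
qed

text \<open>Moving p vertically by at most h^2 reaches a height where the tower consists of tubes of
  width h^2. An open tube cannot contain two points at horizontal distance h^2, so one of two
  candidates leaves the tower.\<close>

lemma tower_frontier_near:
  assumes j: "j \<ge> 1" and p: "p \<in> tower" "level j - (level j)\<^sup>2 / 4 < p$2" "p$2 < 2 * level j"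
  shows "infdist p (frontier tower) \<le> 2 * (level j)\<^sup>2"
proof -
  let ?h = "level j"
  \<comment> \<open>p$2 clamped to the range of heights covered by \<open>tower_gap\<close>.\<close>
  define y where "y = max ?h (min (p$2) (2 * ?h - ?h\<^sup>2))"
  define w where "w t = (vector [p$1 + t, y] :: real^2)" for t
  have h: "?h > 0" "?h\<^sup>2 > 0" "?h\<^sup>2 \<le> ?h / 2" using level_bounds[OF j] level_square[OF j] by blast+
  have y: "?h \<le> y" "y \<le> 2 * ?h - ?h\<^sup>2" "\<bar>p$2 - y\<bar> \<le> ?h\<^sup>2"
    using p h unfolding y_def by linarith+
  have "w 0 \<notin> tower \<or> w (?h\<^sup>2) \<notin> tower"
  proof (rule ccontr)
    assume "\<not> ?thesis"
    then have "w 0 \<in> tower" "w (?h\<^sup>2) \<in> tower" by auto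
    have "\<exists>i. \<bar>w t$1 - centre ?h i\<bar> < ?h\<^sup>2 / 2" if "w t \<in> tower" for t
      using tower_gap[OF j _ _ that] y by (auto simp: w_def)
    then obtain i k where "\<bar>w 0$1 - centre ?h i\<bar> < ?h\<^sup>2 / 2" "\<bar>w (?h\<^sup>2)$1 - centre ?h k\<bar> < ?h\<^sup>2 / 2"
      using \<open>w 0 \<in> tower\<close> \<open>w (?h\<^sup>2) \<in> tower\<close> by blast
    then have ik: "\<bar>p$1 - centre ?h i\<bar> < ?h\<^sup>2 / 2" "\<bar>p$1 + ?h\<^sup>2 - centre ?h k\<bar> < ?h\<^sup>2 / 2"
      by (simp_all add: w_def)
    \<comment> \<open>The centres differ by less than h^2 / 2 + h^2 + h^2 / 2 <= h, whereas distinct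
      centres are at least h apart.\<close>
    then have "\<bar>centre ?h i - centre ?h k\<bar> < ?h" using h by linarith
    then have "i = k" using h centre_diff by blast
    then show False using ik h by (simp add: abs_less_iff)
  qed
  then obtain t where t: "0 \<le> t" "t \<le> ?h\<^sup>2" "w t \<notin> tower"
    using h(2) by (meson less_imp_le order_refl)
  have "infdist p (frontier tower) \<le> dist p (w t)"
    using p(1) t(3) by (rule infdist_frontier_le)
  also have "\<dots> \<le> \<bar>p$1 - w t$1\<bar> + \<bar>p$2 - w t$2\<bar>"
    using norm_le_l1_cart[of "p - w t"] by (simp add: dist_norm sum_2)
  also have "\<dots> \<le> 2 * ?h\<^sup>2" using t y by (simp add: w_def)
  finally show ?thesis .
qed

lemma open_tower: "open tower"
  unfolding tower_def layer_def tube_def by (intro open_UN open_Un ballI open_box)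

lemma bounded_tower: "bounded tower"
proof -
  have "tower \<subseteq> cbox (vector [0, 0]) (vector [1, 1])"
  proof
    fix p assume "p \<in> tower"
    then show "p \<in> cbox (vector [0, 0]) (vector [1, 1])"
    proof (cases rule: tower_cases)
      case (layer j)
      then show ?thesis using level_bounds[of j] level_square[of j]
        by (auto simp: mem_layer mem_box_cart forall_2)
    next
      case (tube j i)
      then show ?thesis using level_bounds[of j] level_square[of j] centre_bounds[OF tube(2)]
        unfolding mem_tube mem_box_cart forall_2 vector_2 abs_less_iff by simp
    qed
  qed
  then show ?thesis using bounded_cbox bounded_subset by blast
qed

text \<open>The centre of the layer of level 1: with h = 1/2, the height 2 h - h^2 / 2 is
  7/8.\<close>

definition basepoint :: "real^2" where
  "basepoint = vector [1/2, 7/8]"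

lemma basepoint_in_tower: "basepoint \<in> tower"
  using layer_subset_tower[of 1] by (auto simp: basepoint_def mem_layer level_def power2_eq_square)

lemma frontier_tower: "frontier tower \<noteq> {}"
proof -
  have "tower \<noteq> UNIV" using bounded_tower not_bounded_UNIV by auto
  then show ?thesis using basepoint_in_tower frontier_eq_empty[of tower] by blast
qed

section \<open>Quasihyperbolic distances in the tower\<close>

lemma qh_reach_tower_segment:
  fixes x y :: "real^2"
  assumes "box a b \<subseteq> tower" "\<delta> > 0"
    and "\<forall>i. a$i + \<delta> \<le> x$i \<and> x$i + \<delta> \<le> b$i" "\<forall>i. a$i + \<delta> \<le> y$i \<and> y$i + \<delta> \<le> b$i"
    and "\<bar>x$1 - y$1\<bar> + \<bar>x$2 - y$2\<bar> \<le> \<delta> * C"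
  shows "qh_reach tower x y (ennreal C)"
proof -
  have "qh_reach tower x y (ennreal (dist x y / \<delta>))"
    using ball_subset_box_if_segment[OF assms(3,4)[rule_format]] assms(1,2) open_tower frontier_tower
    by (intro qh_reach_segment_ball) (blast, simp_all)
  moreover have "dist x y \<le> \<delta> * C"
    using norm_le_l1_cart[of "x - y"] assms(5) by (simp add: dist_norm sum_2)
  then have "dist x y / \<delta> \<le> C" using assms(2) by (simp add: field_simps)
  ultimately show ?thesis by (meson ennreal_leI qh_reach_mono)
qed

lemma qh_reach_layer:
  assumes "j \<ge> 1" "(level j)\<^sup>2 / 2 \<le> x" "x \<le> 1 - (level j)\<^sup>2 / 2"
    "(level j)\<^sup>2 / 2 \<le> x'" "x' \<le> 1 - (level j)\<^sup>2 / 2" "\<bar>x - x'\<bar> \<le> (level j)\<^sup>2 / 2 * C"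
  shows "qh_reach tower (vector [x, 2 * level j - (level j)\<^sup>2 / 2])
    (vector [x', 2 * level j - (level j)\<^sup>2 / 2]) (ennreal C)"
proof (rule qh_reach_tower_segment[where \<delta> = "(level j)\<^sup>2 / 2"])
  show "box (vector [0, 2 * level j - (level j)\<^sup>2]) (vector [1, 2 * level j]) \<subseteq> tower"
    using layer_subset_tower[OF assms(1)] by (simp add: layer_def)
qed (use assms level_square[OF assms(1)] in \<open>simp_all add: forall_2\<close>)

lemma qh_reach_tube:
  assumes "j \<ge> 1" "i < 2^j" "0 < \<delta>" "\<delta> \<le> (level j)\<^sup>2 / 2"
    "level j - (level j)\<^sup>2 / 4 + \<delta> \<le> y" "y + \<delta> \<le> 2 * level j"
    "level j - (level j)\<^sup>2 / 4 + \<delta> \<le> y'" "y' + \<delta> \<le> 2 * level j" "\<bar>y - y'\<bar> \<le> \<delta> * C"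
  shows "qh_reach tower (vector [centre (level j) i, y]) (vector [centre (level j) i, y']) (ennreal C)"
proof (rule qh_reach_tower_segment)
  show "box (vector [centre (level j) i - (level j)\<^sup>2 / 2, level j - (level j)\<^sup>2 / 4])
      (vector [centre (level j) i + (level j)\<^sup>2 / 2, 2 * level j]) \<subseteq> tower"
    using tube_subset_tower[OF assms(1,2)] by (simp add: tube_def)
qed (use assms in \<open>simp_all add: forall_2\<close>)

text \<open>Induction on the depth. For h = \<open>level (Suc j)\<close>, the way along the layer to
  the nearest tube costs 2 / h, the tube 4 / h, and the rest 16 / (2 h) by induction. The total 14 /
  h stays below 16 / h, so the constant reproduces itself.\<close>

lemma qh_reach_midline:
  assumes "j \<ge> 1" "(level j)\<^sup>2 / 2 \<le> x" "x \<le> 1 - (level j)\<^sup>2 / 2"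
  shows "qh_reach tower (vector [x, 2 * level j - (level j)\<^sup>2 / 2]) basepoint (ennreal (16 / level j))"
  using assms
proof (induction j arbitrary: x rule: nat_induct_at_least)
  case base
  have "qh_reach tower (vector [x, 2 * level 1 - (level 1)\<^sup>2 / 2])
      (vector [1/2, 2 * level 1 - (level 1)\<^sup>2 / 2]) (ennreal (16 / level 1))"
    using base by (intro qh_reach_layer) (simp_all add: level_def power2_eq_square)
  then show ?case by (simp add: basepoint_def level_def power2_eq_square)
next
  case (Suc j)
  define h where "h = level (Suc j)"
  have H: "level j = 2 * h" unfolding h_def by (rule level_Suc)
  have "1 \<le> Suc j" by simp
  then have h: "h > 0" "h\<^sup>2 > 0" "h\<^sup>2 \<le> h / 2" "h \<le> 1/2"
    unfolding h_def using level_bounds level_square by blast+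
  have "0 \<le> x" "x < 1" using Suc.prems h unfolding h_def by linarith+
  then obtain i where i: "i < 2^j" "\<bar>x - centre (level j) i\<bar> \<le> level j / 2"
    by (rule ex_centre_near)
  define c where "c = centre (level j) i"
  have c: "h \<le> c" "c \<le> 1 - h" "\<bar>x - c\<bar> \<le> h"
    using centre_bounds[OF i(1)] i(2) by (auto simp: c_def H)
  let ?p = "vector [x, 2 * h - h\<^sup>2 / 2] :: real^2"
  let ?q = "vector [c, 2 * h - h\<^sup>2 / 2] :: real^2"
  let ?r = "vector [c, 2 * level j - (level j)\<^sup>2 / 2] :: real^2"
  have h2: "(h\<^sup>2 / 2) * (2 / h) = h" "(h\<^sup>2 / 2) * (4 / h) = 2 * h"
    using h(1) by (simp_all add: power2_eq_square)
  have q1: "qh_reach tower ?p ?q (ennreal (2 / h))"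
    using Suc.prems c h h2 unfolding h_def by (intro qh_reach_layer) (simp, linarith+)
  \<comment> \<open>The tube of level j starts at the bottom of the layer of level Suc j, so the
    middle height of that layer is h^2 / 2 above its lower end.\<close>
  have q2: "qh_reach tower ?q ?r (ennreal (4 / h))"
    unfolding c_def
    by (rule qh_reach_tube[where \<delta> = "h\<^sup>2 / 2"])
       (use Suc.hyps i h in \<open>simp_all only: h2 H power_mult_distrib, simp_all\<close>)
  have q3: "qh_reach tower ?r basepoint (ennreal (16 / level j))"
    using c h by (intro Suc.IH) (auto simp: H power_mult_distrib)
  have "qh_reach tower ?p basepoint (ennreal (2 / h) + ennreal (4 / h) + ennreal (16 / level j))"
    by (rule qh_reach_trans[OF qh_reach_trans[OF q1 q2] q3])
  also have "ennreal (2 / h) + ennreal (4 / h) + ennreal (16 / level j) = ennreal (14 / h)"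
    using h(1) by (simp add: H add_divide_distrib[symmetric] flip: ennreal_plus)
  finally show ?case
    unfolding h_def[symmetric]
    by (rule qh_reach_mono) (use h(1) in \<open>auto intro!: ennreal_leI divide_right_mono\<close>)
qed

lemma qh_reach_tower_center:
  fixes x y :: "real^2"
  assumes "box a b \<subseteq> tower" "x \<in> box a b" "0 < r" "r \<le> 1/2"
    and "\<forall>i. a$i + r \<le> y$i \<and> y$i + r \<le> b$i" "\<bar>x$1 - y$1\<bar> \<le> r" "\<bar>x$2 - y$2\<bar> \<le> r"
  shows "qh_reach tower x y (ennreal (10 / sqrt (infdist x (frontier tower))))"
proof (rule qh_reach_convex_center)
  show d: "dist x y \<le> 2 * r"
    using norm_le_l1_cart[of "x - y"] assms(6,7) by (simp add: dist_norm sum_2)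
  then show "dist x y \<le> 1" using assms(4) by simp
  show "ball y r \<subseteq> box a b"
    using assms(5) by (intro ball_subset_box_if_segment[where x = y and y = y]) auto
qed (use assms open_tower frontier_tower in \<open>simp_all add: convex_box\<close>)

text \<open>From p first to a point deep inside its layer or tube, at cost 10 / sqrt d, then to the
  base point at cost at most 20 / h. Since d <= 2 h^2, the second cost is at most 40 / sqrt
  d.\<close>

lemma qh_reach_tower:
  assumes "p \<in> tower"
  shows "qh_reach tower p basepoint (ennreal (50 / sqrt (infdist p (frontier tower))))"
proof -
  define d where "d = infdist p (frontier tower)"
  have "p \<notin> frontier tower" using assms open_tower by (auto simp: frontier_def interior_open)
  then have d: "d > 0"
    using frontier_tower infdist_nonneg[of p "frontier tower"]
      in_closed_iff_infdist_zero[of "frontier tower" p] by (fastforce simp: d_def)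
  have "\<exists>j\<ge>1. level j - (level j)\<^sup>2 / 4 < p$2 \<and> p$2 < 2 * level j \<and>
      qh_reach tower p basepoint (ennreal (10 / sqrt d) + ennreal (20 / level j))"
    using assms
  proof (cases rule: tower_cases)
    case (layer j)
    define h where "h = level j"
    have h: "h > 0" "h\<^sup>2 > 0" "h\<^sup>2 \<le> h / 2" "h \<le> 1/2"
      using level_bounds[of j] level_square[of j] layer unfolding h_def by blast+
    have p: "0 < p$1" "p$1 < 1" "2 * h - h\<^sup>2 < p$2" "p$2 < 2 * h"
      using layer(2) by (auto simp: mem_layer h_def)
    \<comment> \<open>The nearest abscissa at distance at least h^2 / 2 from both sides of the
      layer.\<close>
    define x where "x = max (h\<^sup>2 / 2) (min (p$1) (1 - h\<^sup>2 / 2))"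
    have x: "h\<^sup>2 / 2 \<le> x" "x \<le> 1 - h\<^sup>2 / 2" "\<bar>p$1 - x\<bar> \<le> h\<^sup>2 / 2"
      using p h unfolding x_def by linarith+
    have "qh_reach tower p (vector [x, 2 * h - h\<^sup>2 / 2]) (ennreal (10 / sqrt d))"
      unfolding d_def
    proof (rule qh_reach_tower_center[where r = "h\<^sup>2 / 2"])
      show "p \<in> box (vector [0, 2 * h - h\<^sup>2]) (vector [1, 2 * h])"
        using layer(2) by (simp add: layer_def h_def)
      show "box (vector [0, 2 * h - h\<^sup>2]) (vector [1, 2 * h]) \<subseteq> tower"
        using layer_subset_tower[OF layer(1)] by (simp add: layer_def h_def)
      show "\<bar>p$2 - (vector [x, 2 * h - h\<^sup>2 / 2] :: real^2)$2\<bar> \<le> h\<^sup>2 / 2"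
        using p by (simp only: vector_2)
    qed (use h x in \<open>simp_all add: forall_2\<close>)
    from qh_reach_trans[OF this qh_reach_midline[OF layer(1) x(1,2)[unfolded h_def], folded h_def]]
    have "qh_reach tower p basepoint (ennreal (10 / sqrt d) + ennreal (20 / h))"
      by (rule qh_reach_mono) (use h(1) in \<open>auto intro!: add_mono ennreal_leI divide_right_mono\<close>)
    then show ?thesis using layer(1) p h unfolding h_def by (intro exI[of _ j] conjI; linarith?)
  next
    case (tube j i)
    define h where "h = level j"
    define c where "c = centre h i"
    have h: "h > 0" "h\<^sup>2 > 0" "h\<^sup>2 \<le> h / 2" "h \<le> 1/2"
      using level_bounds[of j] level_square[of j] tube unfolding h_def by blast+
    have c: "h / 2 \<le> c" "c \<le> 1 - h / 2" using centre_bounds[OF tube(2)] by (auto simp: c_def h_def)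
    have p: "\<bar>p$1 - c\<bar> < h\<^sup>2 / 2" "h - h\<^sup>2 / 4 < p$2" "p$2 < 2 * h"
      using tube(3) by (auto simp: mem_tube c_def h_def)
    \<comment> \<open>The two bounds are the ends of the tube moved inwards by h^2 / 2.\<close>
    define y where "y = max (h + h\<^sup>2 / 4) (min (p$2) (2 * h - h\<^sup>2 / 2))"
    have y: "h + h\<^sup>2 / 4 \<le> y" "y \<le> 2 * h - h\<^sup>2 / 2" "\<bar>p$2 - y\<bar> \<le> h\<^sup>2 / 2"
      using p h unfolding y_def by linarith+
    have h2: "(h\<^sup>2 / 2) * (4 / h) = 2 * h"
      using h(1) by (simp_all add: power2_eq_square)
    let ?q = "vector [c, y] :: real^2" and ?r = "vector [c, 2 * h - h\<^sup>2 / 2] :: real^2"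
    have q1: "qh_reach tower p ?q (ennreal (10 / sqrt d))"
      unfolding d_def
    proof (rule qh_reach_tower_center[where r = "h\<^sup>2 / 2"])
      show "p \<in> box (vector [c - h\<^sup>2 / 2, h - h\<^sup>2 / 4]) (vector [c + h\<^sup>2 / 2, 2 * h])"
        using tube(3) by (simp add: tube_def c_def h_def)
      show "box (vector [c - h\<^sup>2 / 2, h - h\<^sup>2 / 4]) (vector [c + h\<^sup>2 / 2, 2 * h]) \<subseteq> tower"
        using tube_subset_tower[OF tube(1,2)] by (simp add: tube_def c_def h_def)
    qed (use h y p in \<open>simp_all add: forall_2\<close>)
    have q2: "qh_reach tower ?q ?r (ennreal (4 / h))"
      unfolding c_def h_def
      by (rule qh_reach_tube[where \<delta> = "h\<^sup>2 / 2"])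
         (unfold h_def[symmetric] h2, use tube(1,2) h y in \<open>linarith+ | simp\<close>)
    have q3: "qh_reach tower ?r basepoint (ennreal (16 / h))"
      unfolding h_def using tube(1) by (rule qh_reach_midline) (use c h in \<open>unfold h_def[symmetric], linarith+\<close>)
    have "qh_reach tower p basepoint (ennreal (10 / sqrt d) + (ennreal (4 / h) + ennreal (16 / h)))"
      by (rule qh_reach_trans[OF q1 qh_reach_trans[OF q2 q3]])
    also have "ennreal (4 / h) + ennreal (16 / h) = ennreal (20 / h)"
      using h(1) by (simp add: add_divide_distrib[symmetric] flip: ennreal_plus)
    finally show ?thesis using tube(1) p unfolding h_def by (intro exI[of _ j] conjI)
  qed
  then obtain j where j: "j \<ge> 1" "level j - (level j)\<^sup>2 / 4 < p$2" "p$2 < 2 * level j"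
    and reach: "qh_reach tower p basepoint (ennreal (10 / sqrt d) + ennreal (20 / level j))"
    by blast
  have h: "level j > 0" using level_bounds[OF j(1)] by simp
  have "d \<le> 2 * (level j)\<^sup>2" unfolding d_def by (rule tower_frontier_near[OF j(1) assms j(2,3)])
  also have "\<dots> \<le> (2 * level j)\<^sup>2" by (simp add: power_mult_distrib)
  finally have "sqrt d \<le> 2 * level j" using h by (intro real_le_lsqrt) auto
  then have "20 / level j \<le> 40 / sqrt d" using h d by (simp add: field_simps)
  then have "10 / sqrt d + 20 / level j \<le> 50 / sqrt d" by (simp add: field_simps)
  then have "ennreal (10 / sqrt d) + ennreal (20 / level j) \<le> ennreal (50 / sqrt d)"
    using h d by (simp add: ennreal_leI flip: ennreal_plus)
  then show ?thesis unfolding d_def[symmetric] by (rule qh_reach_mono[OF reach])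
qed

lemma is_domain_tower: "is_domain tower"
proof -
  have "path_component tower x basepoint" if "x \<in> tower" for x
    by (rule qh_reach_imp_path_component(1)[OF qh_reach_tower[OF that]])
  then have "path_connected tower"
    unfolding path_connected_component by (blast intro: path_component_sym path_component_trans)
  then have "connected tower" by (rule path_connected_imp_connected)
  moreover have "tower \<noteq> {}" using basepoint_in_tower by blast
  ultimately show ?thesis using open_tower unfolding is_domain_def by blast
qed

lemma quasihyperbolic_dist_tower:
  assumes "p \<in> tower"
  shows "quasihyperbolic_dist tower p basepoint
    \<le> ennreal (50 * infdist p (frontier tower) powr (- (1/2)))"
proof -
  let ?d = "infdist p (frontier tower)"
  have "?d powr (- (1/2)) = inverse (sqrt ?d)"
    using powr_minus[of ?d "1/2"] powr_half_sqrt[OF infdist_nonneg, of p "frontier tower"] by (simp only:)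
  then have "50 * ?d powr (- (1/2)) = 50 / sqrt ?d" by (simp only: divide_inverse)
  then show ?thesis
    using qh_reach_imp_path_component(2)[OF qh_reach_tower[OF assms]] by (simp only:)
qed

section \<open>Quasiconformality of maps with shear derivative\<close>

lemma abs_continuous_on_interval_lipschitz:
  assumes "\<And>s t. s \<in> {a..b} \<Longrightarrow> t \<in> {a..b} \<Longrightarrow> dist (\<phi> s) (\<phi> t) \<le> L * \<bar>s - t\<bar>" "L \<ge> 0"
  shows "abs_continuous_on_interval a b \<phi>"
  unfolding abs_continuous_on_interval_def
proof (intro allI impI)
  fix \<epsilon> :: real assume \<epsilon>: "\<epsilon> > 0"
  show "\<exists>\<delta>>0. \<forall>(n::nat) u v. (\<forall>i<n. a \<le> u i \<and> u i \<le> v i \<and> v i \<le> b) \<and>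
      disjoint_family_on (\<lambda>i. {u i<..<v i}) {..<n} \<and> (\<Sum>i<n. v i - u i) < \<delta> \<longrightarrow>
      (\<Sum>i<n. dist (\<phi> (u i)) (\<phi> (v i))) < \<epsilon>"
  \<comment> \<open>L + 1 in place of L keeps the witness positive when L = 0.\<close>
  proof (intro exI[of _ "\<epsilon> / (L + 1)"] conjI allI impI)
    show "\<epsilon> / (L + 1) > 0" using \<epsilon> assms(2) by simp
    fix n :: nat and u v
    assume uv: "(\<forall>i<n. a \<le> u i \<and> u i \<le> v i \<and> v i \<le> b) \<and>
      disjoint_family_on (\<lambda>i. {u i<..<v i}) {..<n} \<and> (\<Sum>i<n. v i - u i) < \<epsilon> / (L + 1)"
    have "(\<Sum>i<n. dist (\<phi> (u i)) (\<phi> (v i))) \<le> (\<Sum>i<n. (L + 1) * (v i - u i))"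
    proof (rule sum_mono)
      fix i assume "i \<in> {..<n}"
      then have i: "a \<le> u i" "u i \<le> v i" "v i \<le> b" using uv by auto
      then have "dist (\<phi> (u i)) (\<phi> (v i)) \<le> L * (v i - u i)"
        using assms(1)[of "u i" "v i"] by simp
      also have "\<dots> \<le> (L + 1) * (v i - u i)" using i by (intro mult_right_mono) auto
      finally show "dist (\<phi> (u i)) (\<phi> (v i)) \<le> (L + 1) * (v i - u i)" .
    qed
    also have "\<dots> = (L + 1) * (\<Sum>i<n. v i - u i)" by (simp add: sum_distrib_left)
    also have "\<dots> < (L + 1) * (\<epsilon> / (L + 1))"
      using uv assms(2) by (intro mult_strict_left_mono) auto
    finally show "(\<Sum>i<n. dist (\<phi> (u i)) (\<phi> (v i))) < \<epsilon>" using assms(2) by simp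
  qed
qed

text \<open>Maps of this form are closed under inversion, (\<alpha>, \<beta>) becoming (1 /
  \<alpha>, -\<beta>), and their distortion depends on \<beta> alone.\<close>

definition shear :: "real \<Rightarrow> real \<Rightarrow> real^2 \<Rightarrow> real^2" where
  "shear \<alpha> \<beta> w = \<alpha> *\<^sub>R vector [w$1 - \<beta> * w$2, w$2]"

lemma shear_nth [simp]:
  "shear \<alpha> \<beta> w $ 1 = \<alpha> * (w$1 - \<beta> * w$2)" "shear \<alpha> \<beta> w $ 2 = \<alpha> * w$2"
  by (simp_all add: shear_def)

lemma bounded_linear_shear: "bounded_linear (shear \<alpha> \<beta>)"
  by (intro linear_conv_bounded_linear[THEN iffD1] linearI)
     (simp_all add: vec_eq_iff forall_2 algebra_simps)

lemma norm_power2_2: "(norm (w :: real^2))\<^sup>2 = (w$1)\<^sup>2 + (w$2)\<^sup>2"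
  by (simp add: norm_vec_def L2_set_def sum_2)

lemma norm_shear_le:
  assumes "\<alpha> \<ge> 0"
  shows "norm (shear \<alpha> \<beta> w) \<le> \<alpha> * sqrt (\<beta>\<^sup>2 + 2) * norm w"
proof (rule power2_le_imp_le)
  \<comment> \<open>This sum of squares is the difference of the two sides of the next
    inequality.\<close>
  have "0 \<le> (w$2 + \<beta> * w$1)\<^sup>2 + (w$1)\<^sup>2" by simp
  then have "(w$1 - \<beta> * w$2)\<^sup>2 + (w$2)\<^sup>2 \<le> (\<beta>\<^sup>2 + 2) * ((w$1)\<^sup>2 + (w$2)\<^sup>2)"
    by (simp add: power2_eq_square algebra_simps)
  then have "\<alpha>\<^sup>2 * ((w$1 - \<beta> * w$2)\<^sup>2 + (w$2)\<^sup>2) \<le> \<alpha>\<^sup>2 * ((\<beta>\<^sup>2 + 2) * ((w$1)\<^sup>2 + (w$2)\<^sup>2))"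
    by (rule mult_left_mono) simp
  then show "(norm (shear \<alpha> \<beta> w))\<^sup>2 \<le> (\<alpha> * sqrt (\<beta>\<^sup>2 + 2) * norm w)\<^sup>2"
    by (simp add: norm_power2_2 power_mult_distrib distrib_left mult.assoc)
qed (use assms in simp)

lemma onorm_shear_le: "\<alpha> \<ge> 0 \<Longrightarrow> onorm (shear \<alpha> \<beta>) \<le> \<alpha> * sqrt (\<beta>\<^sup>2 + 2)"
  by (intro onorm_le norm_shear_le)

lemma det_shear: "det (matrix (shear \<alpha> \<beta>)) = \<alpha>\<^sup>2"
  by (simp add: det_2 matrix_def axis_def power2_eq_square)

text \<open>The operator is \<alpha> (P - \<beta> Q) with fixed P and Q, hence continuous in its
  parameters as an element of the normed space of bounded linear maps.\<close>

lemma continuous_on_onorm_shear: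
  assumes "continuous_on S \<alpha>" "continuous_on S \<beta>"
  shows "continuous_on S (\<lambda>z. onorm (shear (\<alpha> z) (\<beta> z)))"
proof -
  define P where "P = Blinfun (shear 1 0)"
  define Q where "Q = Blinfun (\<lambda>w. shear 1 0 w - shear 1 1 w)"
  have P: "blinfun_apply P = shear 1 0"
    unfolding P_def by (rule bounded_linear_Blinfun_apply[OF bounded_linear_shear])
  have Q: "blinfun_apply Q = (\<lambda>w. shear 1 0 w - shear 1 1 w)"
    unfolding Q_def by (intro bounded_linear_Blinfun_apply bounded_linear_sub bounded_linear_shear)
  have "blinfun_apply (\<alpha> z *\<^sub>R (P - \<beta> z *\<^sub>R Q)) = shear (\<alpha> z) (\<beta> z)" for z
    by (rule ext) (simp add: blinfun.diff_left blinfun.scaleR_left P Q vec_eq_iff forall_2 algebra_simps)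
  then have "onorm (shear (\<alpha> z) (\<beta> z)) = norm (\<alpha> z *\<^sub>R (P - \<beta> z *\<^sub>R Q))" for z
    by (simp add: norm_blinfun.rep_eq)
  then show ?thesis using assms by (simp only:) (intro continuous_intros)
qed

section \<open>From the derivative to quasiconformality\<close>

lemma absolutely_integrable_on_compact_continuous:
  fixes \<phi> :: "'a::euclidean_space \<Rightarrow> real"
  assumes "compact Q" "continuous_on Q \<phi>"
  shows "\<phi> absolutely_integrable_on Q"
proof -
  have int: "integrable lborel (\<lambda>x. indicator Q x *\<^sub>R \<phi> x)"
    using assms by (rule borel_integrable_compact)
  then have "(\<lambda>x. indicator Q x *\<^sub>R \<phi> x) \<in> borel_measurable lborel" by simp
  with int show ?thesis unfolding set_integrable_def by (simp add: integrable_completion)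
qed

text \<open>By the mean value inequality f is Lipschitz on each closed rectangle, so absolute
  continuity holds on every segment across it.\<close>

lemma abs_continuous_on_lines_if_bounded_derivative:
  assumes der: "\<And>z. z \<in> \<Omega> \<Longrightarrow> (f has_derivative f' z) (at z)"
    and bound: "\<And>Q. compact Q \<Longrightarrow> Q \<subseteq> \<Omega> \<Longrightarrow> \<exists>L\<ge>0. \<forall>z\<in>Q. onorm (f' z) \<le> L"
  shows "abs_continuous_on_lines \<Omega> f"
  unfolding abs_continuous_on_lines_def
proof (intro allI impI conjI)
  fix a b assume ab: "cbox a b \<subseteq> \<Omega> \<and> cbox a b \<noteq> {}"
  then obtain L where L: "L \<ge> 0" "\<And>z. z \<in> cbox a b \<Longrightarrow> onorm (f' z) \<le> L"
    using bound[of "cbox a b"] by auto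
  have lip: "dist (f z) (f w) \<le> L * dist z w" if "z \<in> cbox a b" "w \<in> cbox a b" for z w
    unfolding dist_norm
  proof (rule differentiable_bound[OF convex_box(1)])
    show "(f has_derivative f' u) (at u within cbox a b)" if "u \<in> cbox a b" for u
      using der that ab by (blast intro: has_derivative_at_withinI)
  qed (use that L in auto)
  have [simp]: "dist (vector [s, t] :: real^2) (vector [s', t]) = \<bar>s - s'\<bar>"
      "dist (vector [t, s] :: real^2) (vector [t, s']) = \<bar>s - s'\<bar>" for s s' t :: real
    by (simp_all add: dist_norm norm_vec_def L2_set_def sum_2)
  show "AE t in lborel. t \<in> {a$2..b$2} \<longrightarrow>
      abs_continuous_on_interval (a$1) (b$1) (\<lambda>s. f (vector [s, t]))"
  proof (intro AE_I2 impI, rule abs_continuous_on_interval_lipschitz[OF _ L(1)])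
    fix t s s' assume "t \<in> {a$2..b$2}" "s \<in> {a$1..b$1}" "s' \<in> {a$1..b$1}"
    then show "dist (f (vector [s, t])) (f (vector [s', t])) \<le> L * \<bar>s - s'\<bar>"
      using lip[of "vector [s, t]" "vector [s', t]"] by (simp add: mem_box_cart forall_2)
  qed
  show "AE s in lborel. s \<in> {a$1..b$1} \<longrightarrow>
      abs_continuous_on_interval (a$2) (b$2) (\<lambda>t. f (vector [s, t]))"
  proof (intro AE_I2 impI, rule abs_continuous_on_interval_lipschitz[OF _ L(1)])
    fix t s s' assume "t \<in> {a$1..b$1}" "s \<in> {a$2..b$2}" "s' \<in> {a$2..b$2}"
    then show "dist (f (vector [t, s])) (f (vector [t, s'])) \<le> L * \<bar>s - s'\<bar>"
      using lip[of "vector [t, s]" "vector [t, s']"] by (simp add: mem_box_cart forall_2)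
  qed
qed

text \<open>The squared operator norm is at most \<alpha>^2 (\<beta>^2 + 2) and the Jacobian
  determinant is \<alpha>^2, so a bound B for |\<beta>| gives K = B^2 + 2.\<close>

lemma K_quasiconformal_shear:
  assumes dom: "is_domain \<Omega>" "is_domain \<Omega>'" "homeomorphism \<Omega> \<Omega>' f g"
    and der: "\<And>z. z \<in> \<Omega> \<Longrightarrow> (f has_derivative shear (\<alpha> z) (\<beta> z)) (at z)"
    and cont: "continuous_on \<Omega> \<alpha>" "continuous_on \<Omega> \<beta>"
    and pos: "\<And>z. z \<in> \<Omega> \<Longrightarrow> \<alpha> z \<ge> 0"
    and bound: "\<And>z. z \<in> \<Omega> \<Longrightarrow> \<bar>\<beta> z\<bar> \<le> B"
  shows "K_quasiconformal (B\<^sup>2 + 2) \<Omega> \<Omega>' f"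
proof -
  let ?n = "\<lambda>z. onorm (shear (\<alpha> z) (\<beta> z))"
  have fd: "frechet_derivative f (at z) = shear (\<alpha> z) (\<beta> z)" if "z \<in> \<Omega>" for z
    using frechet_derivative_at[OF der[OF that]] by simp
  have n_cont: "continuous_on \<Omega> ?n" using cont by (rule continuous_on_onorm_shear)
  have "abs_continuous_on_lines \<Omega> f"
  proof (rule abs_continuous_on_lines_if_bounded_derivative[OF der])
    fix Q assume Q: "compact Q" "Q \<subseteq> \<Omega>"
    then have "compact (?n ` Q)"
      using n_cont by (intro compact_continuous_image) (auto intro: continuous_on_subset)
    then obtain L where "\<forall>y\<in>?n ` Q. norm y \<le> L"
      using compact_imp_bounded bounded_iff by blast
    then have "\<forall>z\<in>Q. ?n z \<le> max 0 L" by fastforce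
    then show "\<exists>L\<ge>0. \<forall>z\<in>Q. ?n z \<le> L" by (intro exI[of _ "max 0 L"]) auto
  qed
  moreover have "(\<lambda>x. (onorm (frechet_derivative f (at x)))\<^sup>2) absolutely_integrable_on Q"
    if Q: "compact Q" "Q \<subseteq> \<Omega>" for Q
  proof -
    have "(\<lambda>x. (?n x)\<^sup>2) absolutely_integrable_on Q"
      using Q n_cont
      by (intro absolutely_integrable_on_compact_continuous continuous_intros)
         (auto intro: continuous_on_subset)
    then show ?thesis
      using Q fd by (subst set_integrable_cong[OF refl refl]) auto
  qed
  moreover have "AE x in lebesgue_on \<Omega>. f differentiable (at x) \<and>
      (onorm (frechet_derivative f (at x)))\<^sup>2 \<le> (B\<^sup>2 + 2) * det (jacobian f (at x))"
  proof (rule AE_I2, rule conjI)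
    fix x assume "x \<in> space (lebesgue_on \<Omega>)"
    then have x: "x \<in> \<Omega>" by simp
    show "f differentiable (at x)" using der[OF x] differentiable_def by blast
    have "(?n x)\<^sup>2 \<le> (\<alpha> x * sqrt ((\<beta> x)\<^sup>2 + 2))\<^sup>2"
      using onorm_shear_le[OF pos[OF x], of "\<beta> x"]
      by (intro power_mono onorm_pos_le bounded_linear_shear) auto
    also have "\<dots> = (\<alpha> x)\<^sup>2 * ((\<beta> x)\<^sup>2 + 2)" by (simp add: power_mult_distrib)
    also have "\<dots> \<le> (\<alpha> x)\<^sup>2 * (B\<^sup>2 + 2)"
      using bound[OF x] by (intro mult_left_mono) (auto simp: abs_le_square_iff[symmetric])
    finally show "(onorm (frechet_derivative f (at x)))\<^sup>2 \<le> (B\<^sup>2 + 2) * det (jacobian f (at x))"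
      by (simp add: fd[OF x] jacobian_def det_shear mult.commute)
  qed
  ultimately show ?thesis
    using dom unfolding K_quasiconformal_def by blast
qed

section \<open>Logarithmic height\<close>

lemma DERIV_positive_part_square:
  "((\<lambda>t::real. (max 0 t)\<^sup>2) has_real_derivative 2 * max 0 x) (at x)"
proof -
  consider "x < 0" | "x = 0" | "x > 0" by linarith
  then show ?thesis
  proof cases
    case 1
    have "((\<lambda>_. 0) has_real_derivative 2 * max 0 x) (at x)" using 1 by simp
    then show ?thesis
      by (rule DERIV_cong_ev[OF refl _ refl, THEN iffD1, rotated])
         (use 1 in \<open>auto intro!: eventually_mono[OF eventually_nhds_in_open[of "{..<0}" x]]\<close>)
  next
    case 2
    have "(\<lambda>h. (max 0 h)\<^sup>2 / h) \<midarrow>0\<rightarrow> (0::real)"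
    proof (rule Lim_null_comparison)
      show "\<forall>\<^sub>F h in at 0. norm ((max 0 h)\<^sup>2 / h) \<le> \<bar>h :: real\<bar>"
        by (intro always_eventually) (auto simp: max_def power2_eq_square)
      show "((\<lambda>h::real. \<bar>h\<bar>) \<longlongrightarrow> 0) (at 0)" by (rule tendsto_eq_intros | simp)+
    qed
    then show ?thesis using 2 by (simp add: has_field_derivative_iff)
  next
    case 3
    have "((\<lambda>t. t\<^sup>2) has_real_derivative 2 * max 0 x) (at x)"
      using 3 by (auto intro!: derivative_eq_intros)
    then show ?thesis
      by (rule DERIV_cong_ev[OF refl _ refl, THEN iffD1, rotated])
         (use 3 in \<open>auto intro!: eventually_mono[OF eventually_nhds_in_open[of "{0<..}" x]]\<close>)
  qed
qed

text \<open>The exponent 5 makes the integral of \<open>bump h\<close> over a gap of length about \<open>h\<close> comparable to 1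
  for all \<open>h\<close>, so that \<open>log_height\<close> drops by a fixed amount with each level. The squares make
  \<open>bump h\<close> continuously differentiable.\<close>

definition bump :: "real \<Rightarrow> real \<Rightarrow> real" where
  "bump h y = 8 / h^5 * ((max 0 (y - h))\<^sup>2 * (max 0 (2 * h - h\<^sup>2 - y))\<^sup>2)"

definition bump' :: "real \<Rightarrow> real \<Rightarrow> real" where
  "bump' h y = 16 / h^5 * (max 0 (y - h) * (max 0 (2 * h - h\<^sup>2 - y))\<^sup>2
     - (max 0 (y - h))\<^sup>2 * max 0 (2 * h - h\<^sup>2 - y))"

lemma DERIV_bump: "(bump h has_real_derivative bump' h y) (at y)"
proof -
  have 1: "((\<lambda>y. (max 0 (y - h))\<^sup>2) has_real_derivative 2 * max 0 (y - h) * 1) (at y)"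
    by (rule DERIV_chain2[OF DERIV_positive_part_square]) (auto intro!: derivative_eq_intros)
  have 2: "((\<lambda>y. (max 0 (2 * h - h\<^sup>2 - y))\<^sup>2) has_real_derivative 2 * max 0 (2 * h - h\<^sup>2 - y) * -1) (at y)"
    by (rule DERIV_chain2[OF DERIV_positive_part_square]) (auto intro!: derivative_eq_intros)
  show ?thesis
    unfolding bump_def[abs_def]
    by (rule DERIV_cong[OF DERIV_cmult[OF DERIV_mult[OF 1 2]]]) (simp add: bump'_def algebra_simps)
qed

lemma continuous_bump': "isCont (bump' h) y"
  unfolding bump'_def[abs_def] by (intro continuous_intros)

lemma bump_nonneg: "h > 0 \<Longrightarrow> bump h y \<ge> 0"
  by (simp add: bump_def)

lemma bump_eq_0: "y \<le> h \<or> 2 * h - h\<^sup>2 \<le> y \<Longrightarrow> bump h y = 0 \<and> bump' h y = 0"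
  by (auto simp: bump_def bump'_def)

text \<open>Where both positive parts u and v are nonzero, u + v <= h and hence u v <= h^2 / 4. The
  first bound keeps a widened tube within its cell of width h; the second, against the half-width
  h^2 / 2 of the tube, bounds the shear.\<close>

lemma bump_bounds:
  assumes "h > 0"
  shows "bump h y \<le> 1 / (2 * h)" and "\<bar>bump' h y\<bar> \<le> 4 / h\<^sup>2"
proof -
  define u v where "u = max 0 (y - h)" and "v = max 0 (2 * h - h\<^sup>2 - y)"
  have h5: "h^5 = h * (h\<^sup>2)\<^sup>2" by (simp flip: power_mult power_Suc)
  have uv: "u \<ge> 0" "v \<ge> 0" by (auto simp: u_def v_def)
  have *: "bump h y \<le> 1 / (2 * h) \<and> \<bar>bump' h y\<bar> \<le> 4 / h\<^sup>2"
  proof (cases "u = 0 \<or> v = 0")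
    case True
    then show ?thesis using assms by (auto simp: bump_def bump'_def u_def v_def)
  next
    case False
    then have le: "u + v \<le> h" by (auto simp: u_def v_def max_def split: if_splits)
    have "4 * (u * v) \<le> 4 * (u * v) + (u - v)\<^sup>2" by simp
    also have "\<dots> = (u + v)\<^sup>2" by (simp add: power2_eq_square algebra_simps)
    also have "\<dots> \<le> h\<^sup>2" using le uv by (intro power_mono) auto
    finally have prod: "u * v \<le> h\<^sup>2 / 4" by simp
    have "(u * v)\<^sup>2 \<le> (h\<^sup>2 / 4)\<^sup>2" using prod uv by (intro power_mono) auto
    then have "8 / h^5 * (u * v)\<^sup>2 \<le> 8 / h^5 * (h\<^sup>2 / 4)\<^sup>2" using assms by (intro mult_left_mono) auto
    also have "\<dots> = 1 / (2 * h)" using assms by (simp add: h5 power_divide)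
    finally have 1: "bump h y \<le> 1 / (2 * h)" by (simp add: bump_def u_def v_def power_mult_distrib)
    have "\<bar>v - u\<bar> \<le> h" using uv le by linarith
    then have "(u * v) * \<bar>v - u\<bar> \<le> h\<^sup>2 / 4 * h" using prod uv by (intro mult_mono) auto
    then have "16 / h^5 * ((u * v) * \<bar>v - u\<bar>) \<le> 16 / h^5 * (h\<^sup>2 / 4 * h)"
      using assms by (intro mult_left_mono) auto
    also have "\<dots> = 4 / h\<^sup>2" using assms by (simp add: h5 power2_eq_square)
    also have "16 / h^5 * ((u * v) * \<bar>v - u\<bar>) = \<bar>16 / h^5 * (u * v * (v - u))\<bar>"
      using assms uv by (simp add: abs_mult)
    also have "16 / h^5 * (u * v * (v - u)) = bump' h y"
      by (simp add: bump'_def u_def v_def power2_eq_square algebra_simps)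
    finally show ?thesis using 1 by simp
  qed
  then show "bump h y \<le> 1 / (2 * h)" and "\<bar>bump' h y\<bar> \<le> 4 / h\<^sup>2" by auto
qed

text \<open>For 0 < y < 2 this is the power h of 1/2 with h <= y < 2 h.\<close>

definition level_of :: "real \<Rightarrow> real" where
  "level_of y = level (LEAST j. level j \<le> y)"

lemma level_of_eq:
  assumes "level j \<le> y" "y < 2 * level j"
  shows "level_of y = level j"
proof -
  have "(LEAST j. level j \<le> y) = j"
  proof (rule Least_equality)
    show "j \<le> k" if "level k \<le> y" for k
      using level_less[of k j] that assms(2) by (cases "k < j") auto
  qed (rule assms(1))
  then show ?thesis by (simp add: level_of_def)
qed

lemma ex_level:
  assumes "0 < y" "y < 1"
  obtains j where "j \<ge> 1" "level j \<le> y" "y < 2 * level j"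
proof -
  obtain n where "(1/2::real) ^ n < y" using real_arch_pow_inv[OF assms(1), of "1/2"] by auto
  then have ex: "\<exists>j. level j \<le> y" by (auto simp: level_def intro: less_imp_le)
  define j where "j = (LEAST j. level j \<le> y)"
  have j: "level j \<le> y" unfolding j_def by (rule LeastI_ex[OF ex])
  then have "j \<noteq> 0" using assms(2) by (cases "j = 0") (simp_all add: level_def)
  then obtain k where k: "j = Suc k" using not0_implies_Suc by blast
  then have "\<not> level k \<le> y" using not_less_Least[of k "\<lambda>j. level j \<le> y"] by (simp add: j_def)
  then show thesis using that[of j] j k level_Suc[of k] by simp
qed

definition stretch :: "real \<Rightarrow> real" where
  "stretch y = bump (level_of y) y"

definition stretch' :: "real \<Rightarrow> real" where
  "stretch' y = bump' (level_of y) y"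

lemma level_pos [simp]: "level j > 0"
  by (simp add: level_def)

lemma level_le_1: "level j \<le> 1"
  by (simp add: level_def power_le_one)

text \<open>The formula of level j persists below level j, down to the bottom of the next layer,
  because both adjacent bumps vanish there. The resulting overlapping open intervals allow
  differentiation across the levels.\<close>

lemma stretch_eq_bump:
  assumes "level j - (level j)\<^sup>2 / 4 < y" "y < 2 * level j"
  shows "stretch y = bump (level j) y" "stretch' y = bump' (level j) y"
proof -
  have "stretch y = bump (level j) y \<and> stretch' y = bump' (level j) y"
  proof (cases "level j \<le> y")
    case True
    then show ?thesis using level_of_eq[OF True assms(2)] by (simp add: stretch_def stretch'_def)
  next
    case False
    have h: "level j = 2 * level (Suc j)" by (rule level_Suc)
    have "(level j)\<^sup>2 \<le> level j"
      using mult_left_mono[OF level_le_1[of j], of "level j"] level_pos[of j]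
      by (simp add: power2_eq_square)
    then have "level (Suc j) \<le> y" using assms(1) h level_pos[of j] by linarith
    then have "level_of y = level (Suc j)" using False h by (intro level_of_eq) auto
    moreover have "2 * level (Suc j) - (level (Suc j))\<^sup>2 \<le> y"
      using assms(1) by (simp add: h power_mult_distrib)
    ultimately show ?thesis
      using False bump_eq_0[of y "level (Suc j)"] bump_eq_0[of y "level j"]
      by (simp add: stretch_def stretch'_def)
  qed
  then show "stretch y = bump (level j) y" "stretch' y = bump' (level j) y" by auto
qed

lemma ex_level_nbhd:
  assumes "0 < y" "y < 2"
  obtains j where "y \<in> {level j - (level j)\<^sup>2 / 4 <..< 2 * level j}"
proof (cases "y < 1")
  case True
  then obtain j where "level j \<le> y" "y < 2 * level j" using ex_level[OF assms(1)] by blast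
  moreover have "0 < (level j)\<^sup>2" using level_pos by (rule zero_less_power)
  ultimately have "level j - (level j)\<^sup>2 / 4 < y" by linarith
  then show thesis using that[of j] \<open>y < 2 * level j\<close> by simp
next
  case False
  then show thesis using that[of 0] assms by (simp add: level_def)
qed

text \<open>The range extends beyond 1 because \<open>ex_primitive\<close> integrates up to the end
  point 1.\<close>

lemma DERIV_stretch:
  assumes "0 < y" "y < 2"
  shows "(stretch has_real_derivative stretch' y) (at y)" "isCont stretch' y"
proof -
  obtain j where j: "y \<in> {level j - (level j)\<^sup>2 / 4 <..< 2 * level j}"
    using ex_level_nbhd[OF assms] .
  have ev: "\<forall>\<^sub>F x in nhds y. x \<in> {level j - (level j)\<^sup>2 / 4 <..< 2 * level j}"
    using j by (intro eventually_nhds_in_open) auto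
  have "\<forall>\<^sub>F x in nhds y. bump (level j) x = stretch x"
    using ev by eventually_elim (use stretch_eq_bump[of j] in auto)
  from DERIV_cong_ev[OF refl this refl] show "(stretch has_real_derivative stretch' y) (at y)"
    using DERIV_bump[of "level j" y] j by (simp add: stretch_eq_bump(2)[of j])
  have "\<forall>\<^sub>F x in nhds y. bump' (level j) x = stretch' x"
    using ev by eventually_elim (use stretch_eq_bump[of j] in auto)
  from isCont_cong[OF this] show "isCont stretch' y"
    using continuous_bump' by blast
qed

lemma stretch_nonneg: "stretch y \<ge> 0"
  unfolding stretch_def level_of_def by (rule bump_nonneg[OF level_pos])

text \<open>The witness is minus the integral from y to 1. The fundamental theorem is applied from a
  lower end e = y / 2 that depends on y, and subtracting the constant integral over [e, 1] removes
  e.\<close>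

lemma ex_primitive:
  obtains U where "\<And>y. 0 < y \<Longrightarrow> y < 1 \<Longrightarrow> (U has_real_derivative 1 + stretch y) (at y)"
proof
  let ?F = "\<lambda>y. 1 + stretch y"
  fix y :: real assume y: "0 < y" "y < 1"
  define e where "e = y / 2"
  have cont: "continuous_on {e..1} ?F"
  proof (intro continuous_at_imp_continuous_on ballI)
    fix x assume "x \<in> {e..1}"
    then have "isCont stretch x" using y DERIV_stretch(1)[of x] DERIV_isCont by (auto simp: e_def)
    then show "isCont ?F x" by (intro continuous_intros)
  qed
  have "((\<lambda>x. integral {e..x} ?F) has_real_derivative ?F y) (at y within {e..1})"
    using cont y by (intro integral_has_real_derivative) (auto simp: e_def)
  then have "((\<lambda>x. integral {e..x} ?F - integral {e..1} ?F) has_real_derivative ?F y) (at y within {e..1})"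
    by (auto intro!: derivative_eq_intros)
  then have "((\<lambda>x. - integral {x..1} ?F) has_real_derivative ?F y) (at y within {e..1})"
  proof (rule has_field_derivative_transform_within[of _ _ _ _ 1])
    fix x assume "x \<in> {e..1}"
    then have "integral {e..x} ?F + integral {x..1} ?F = integral {e..1} ?F"
      using cont by (intro Henstock_Kurzweil_Integration.integral_combine integrable_continuous_interval) auto
    then show "integral {e..x} ?F - integral {e..1} ?F = - integral {x..1} ?F" by simp
  qed (use y in \<open>auto simp: e_def\<close>)
  then show "((\<lambda>x. - integral {x..1} ?F) has_real_derivative ?F y) (at y)"
    using y by (subst (asm) at_within_interior) (auto simp: e_def)
qed

definition log_height :: "real \<Rightarrow> real" where
  "log_height = (SOME U. \<forall>y. 0 < y \<and> y < 1 \<longrightarrow> (U has_real_derivative 1 + stretch y) (at y))"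

lemma DERIV_log_height:
  assumes "0 < y" "y < 1"
  shows "(log_height has_real_derivative 1 + stretch y) (at y)"
proof -
  have "\<exists>U. \<forall>y. 0 < y \<and> y < 1 \<longrightarrow> (U has_real_derivative 1 + stretch y) (at y)"
    by (rule ex_primitive) blast
  from someI_ex[OF this] show ?thesis using assms unfolding log_height_def by blast
qed

lemma log_height_increment:
  assumes "0 < x" "x \<le> y" "y < 1" "C \<ge> 0" and "\<And>z. x \<le> z \<Longrightarrow> z \<le> y \<Longrightarrow> C \<le> 1 + stretch z"
  shows "log_height x + C * (y - x) \<le> log_height y"
proof (cases "x = y")
  case False
  then have "x < y" using assms by simp
  from MVT2[OF this, of log_height "\<lambda>z. 1 + stretch z"]
  obtain z where z: "x < z" "z < y" "log_height y - log_height x = (y - x) * (1 + stretch z)"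
    using DERIV_log_height assms by auto
  have "(y - x) * C \<le> (y - x) * (1 + stretch z)"
    using assms z \<open>x < y\<close> by (intro mult_left_mono) auto
  then show ?thesis using z(3) mult.commute[of C "y - x"] by linarith
qed simp

lemma log_height_less:
  assumes "0 < x" "x < y" "y < 1"
  shows "log_height x < log_height y"
proof -
  have "log_height x + 1 * (y - x) \<le> log_height y"
    using assms stretch_nonneg by (intro log_height_increment) auto
  then show ?thesis using assms(2) by simp
qed

text \<open>On this interval of length h / 4 both positive parts are at least h / 8, and 8 / h^5 *
  (h / 8)^4 = 1 / (512 h).\<close>

lemma bump_middle:
  assumes "h > 0" "h \<le> 1/2" "h + h / 8 \<le> y" "y \<le> h + 3 * h / 8"
  shows "bump h y \<ge> 1 / (512 * h)"
proof -
  have h2: "h\<^sup>2 \<le> h / 2"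
    using mult_left_mono[OF assms(2), of h] assms(1) by (simp add: power2_eq_square)
  have "h / 8 \<le> y - h" "h / 8 \<le> 2 * h - h\<^sup>2 - y" using assms(3,4) h2 by linarith+
  then have u: "h / 8 \<le> max 0 (y - h)" "h / 8 \<le> max 0 (2 * h - h\<^sup>2 - y)"
    by (simp_all only: max.coboundedI2)
  have "h^5 = h * (h\<^sup>2)\<^sup>2" by (simp flip: power_mult power_Suc)
  then have "1 / (512 * h) = 8 / h^5 * ((h / 8)\<^sup>2 * (h / 8)\<^sup>2)"
    using assms(1) by (simp add: power2_eq_square)
  also have "\<dots> \<le> bump h y"
    unfolding bump_def using assms(1) by (intro mult_left_mono mult_mono power_mono u) simp_all
  finally show ?thesis .
qed

text \<open>The middle part of each gap alone contributes (h / 4) / (512 h) = 1 / 2048,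
  independently of h.\<close>

lemma log_height_level: "log_height (level (Suc j)) \<le> log_height (1/2) - real j / 2048"
proof (induction j)
  case 0
  then show ?case by (simp add: level_def)
next
  case (Suc j)
  define h where "h = level (Suc (Suc j))"
  have H: "level (Suc j) = 2 * h" unfolding h_def by (rule level_Suc)
  have "1 \<le> Suc (Suc j)" "1 \<le> Suc j" by auto
  then have h: "h > 0" "2 * h \<le> 1/2" unfolding h_def H[symmetric, unfolded h_def]
    using level_bounds by blast+
  have "1 / (512 * h) \<le> 1 + stretch z" if "h + h / 8 \<le> z" "z \<le> h + 3 * h / 8" for z
  proof -
    have "stretch z = bump h z"
      using stretch_eq_bump(1)[of "Suc (Suc j)" z, folded h_def] that h zero_le_power2[of h] by linarith
    then show ?thesis using bump_middle[of h z] that h by simp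
  qed
  then have "log_height (h + h / 8) + 1 / (512 * h) * (h + 3 * h / 8 - (h + h / 8)) \<le> log_height (h + 3 * h / 8)"
    using h by (intro log_height_increment) auto
  moreover have "1 / (512 * h) * (h + 3 * h / 8 - (h + h / 8)) = 1 / 2048"
    using h by (simp add: field_simps)
  moreover have "log_height h < log_height (h + h / 8)" using h by (intro log_height_less) auto
  moreover have "log_height (h + 3 * h / 8) < log_height (2 * h)" using h by (intro log_height_less) auto
  ultimately have "log_height h \<le> log_height (2 * h) - 1 / 2048" by linarith
  then show ?case using Suc.IH unfolding H h_def[symmetric] by (simp add: field_simps)
qed

text \<open>The exponential turns the fixed drop per level into a fixed factor;
  \<open>height\<close> is both the new vertical coordinate and the scale of the image at that
  depth.\<close>

definition height :: "real \<Rightarrow> real" where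
  "height y = exp (log_height y)"

lemma height_pos [simp]: "height y > 0"
  by (simp add: height_def)

lemma DERIV_height:
  assumes "0 < y" "y < 1"
  shows "(height has_real_derivative height y * (1 + stretch y)) (at y)"
  unfolding height_def[abs_def] using DERIV_log_height[OF assms]
  by (auto intro!: derivative_eq_intros)

lemma height_inj:
  assumes "0 < x" "x < 1" "0 < y" "y < 1" "height x = height y"
  shows "x = y"
  using assms log_height_less[of x y] log_height_less[of y x] by (force simp: height_def)

lemma height_small:
  assumes "\<delta> > 0"
  obtains j where "j \<ge> 1" "height (2 * level j - (level j)\<^sup>2 / 2) < \<delta>"
proof -
  \<comment> \<open>n levels of drop 1 / 2048 bring \<open>log_height\<close> below ln \<delta>; the
    layer of level n + 2 lies just below the height \<open>level (Suc n)\<close>.\<close>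
  obtain n :: nat where n: "real n > 2048 * (log_height (1/2) - ln \<delta>)" using reals_Archimedean2 by blast
  define h where "h = level (Suc (Suc n))"
  have H: "level (Suc n) = 2 * h" unfolding h_def by (rule level_Suc)
  have h: "h > 0" "h\<^sup>2 > 0" "2 * h \<le> 1/2" "h\<^sup>2 \<le> h / 2"
    using level_bounds[of "Suc n"] level_square[of "Suc (Suc n)"] H by (auto simp: h_def)
  have "log_height (2 * h - h\<^sup>2 / 2) < log_height (2 * h)" using h by (intro log_height_less) linarith+
  also have "\<dots> \<le> log_height (1/2) - real n / 2048"
    using log_height_level[of n] by (simp only: H)
  also have "\<dots> < ln \<delta>" using n by (simp add: field_simps)
  finally have "height (2 * h - h\<^sup>2 / 2) < exp (ln \<delta>)" unfolding height_def by simp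
  then show thesis using that[of "Suc (Suc n)"] assms by (simp add: h_def)
qed

section \<open>The quasiconformal mapping\<close>

text \<open>The signed distance from x to the centre of the cell [k h, (k + 1) h) containing it;
  each tube of scale h lies in the middle of such a cell.\<close>

definition offset :: "real \<Rightarrow> real \<Rightarrow> real" where
  "offset h x = x - h * (of_int \<lfloor>x / h\<rfloor> + 1/2)"

definition shift :: "real^2 \<Rightarrow> real" where
  "shift p = offset (level_of (p$2)) (p$1)"

definition horiz :: "real^2 \<Rightarrow> real" where
  "horiz p = p$1 + shift p * stretch (p$2)"

text \<open>The preimage of the tower is the image of this map, and the quasiconformal mapping is its
  inverse. Along a tube of level \<open>j\<close> the horizontal stretching about the centre line and the vertical
  derivative of \<open>log_height\<close> are both \<open>1 + stretch\<close>, so the map is conformal up to a shear; near the two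
  ends of the tube and in the layers \<open>stretch\<close> vanishes, which makes the definition consistent across
  tubes with different centres.\<close>

definition unfold_map :: "real^2 \<Rightarrow> real^2" where
  "unfold_map p = vector [height (p$2) * horiz p, height (p$2)]"

section \<open>Tubes, cells and injectivity\<close>

lemma offset_eq:
  assumes "\<bar>x - centre h i\<bar> < h / 2"
  shows "offset h x = x - centre h i"
proof -
  have h: "h > 0" using assms by linarith
  have "\<bar>x - (h * real i + h / 2)\<bar> < h / 2" using assms by (simp add: centre_def distrib_left)
  then have "h * real i \<le> x" "x < h * real i + h" by linarith+
  then have "\<lfloor>x / h\<rfloor> = int i" using h by (intro floor_unique) (simp_all add: field_simps)
  then show ?thesis by (simp add: offset_def centre_def)
qed

lemma tower_coords:
  assumes "p \<in> tower"
  shows "0 < p$1" "p$1 < 1" "0 < p$2" "p$2 < 1"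
proof -
  have "0 < p$1 \<and> p$1 < 1 \<and> 0 < p$2 \<and> p$2 < 1"
    using assms
  proof (cases rule: tower_cases)
    case (layer j)
    show ?thesis using layer(2) level_bounds[OF layer(1)] level_square[OF layer(1)]
      unfolding mem_layer by linarith
  next
    case (tube j i)
    show ?thesis using tube(3) level_bounds[OF tube(1)] level_square[OF tube(1)] centre_bounds[OF tube(2)]
      unfolding mem_tube by linarith
  qed
  then show "0 < p$1" "p$1 < 1" "0 < p$2" "p$2 < 1" by auto
qed

text \<open>\<open>shift\<close> jumps between cells, but its products with \<open>stretch\<close>
  and \<open>stretch'\<close> are locally given by one fixed centre c: in a tube c is its centre,
  and in a layer both factors vanish.\<close>

lemma tower_local:
  assumes "p \<in> tower"
  obtains S c where "open S" "p \<in> S" "S \<subseteq> tower"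
    "\<forall>q\<in>S. \<forall>\<psi>\<in>{stretch, stretch'}. shift q * \<psi> (q$2) = (q$1 - c) * \<psi> (q$2)"
  using assms
proof (cases rule: tower_cases)
  case (layer j)
  have "stretch (q$2) = 0 \<and> stretch' (q$2) = 0" if "q \<in> layer (level j)" for q
  proof -
    have q: "2 * level j - (level j)\<^sup>2 < q$2" "q$2 < 2 * level j" using that by (auto simp: mem_layer)
    then have "level j - (level j)\<^sup>2 / 4 < q$2" using level_square[OF layer(1)] level_pos[of j] by linarith
    then show ?thesis using stretch_eq_bump[of j "q$2"] bump_eq_0[of "q$2" "level j"] q by simp
  qed
  then show thesis
    using layer layer_subset_tower by (intro that[of "layer (level j)" 0]) (auto simp: layer_def)
next
  case (tube j i)
  define h where "h = level j"
  show thesis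
  proof (rule that[of "tube h (centre h i)" "centre h i"])
    have "shift q * \<psi> (q$2) = (q$1 - centre h i) * \<psi> (q$2)"
      if q: "q \<in> tube h (centre h i)" and \<psi>: "\<psi> \<in> {stretch, stretch'}" for q \<psi>
    proof (cases "h \<le> q$2")
      case True
      then have "level_of (q$2) = h" using q unfolding h_def by (intro level_of_eq) (auto simp: mem_tube)
      moreover have "\<bar>q$1 - centre h i\<bar> < h / 2"
        using q level_square[OF tube(1)] level_pos[of j] unfolding mem_tube h_def by linarith
      ultimately show ?thesis by (simp add: shift_def offset_eq)
    next
      \<comment> \<open>Here q lies at the height of the next layer, where \<open>shift\<close>
        refers to the finer cells but the other factor is 0.\<close>
      case False
      then have "\<psi> (q$2) = 0"
        using \<psi> q stretch_eq_bump[of j "q$2"] bump_eq_0[of "q$2" h] by (auto simp: mem_tube h_def)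
      then show ?thesis by simp
    qed
    then show "\<forall>q\<in>tube h (centre h i). \<forall>\<psi>\<in>{stretch, stretch'}.
        shift q * \<psi> (q$2) = (q$1 - centre h i) * \<psi> (q$2)" by blast
    show "tube h (centre h i) \<subseteq> tower" using tube tube_subset_tower unfolding h_def by blast
  qed (use tube in \<open>auto simp: h_def tube_def\<close>)
qed

text \<open>In a gap the half-width h^2 / 2 is multiplied by at most 1 + 1 / (2 h), giving h^2 / 2 +
  h / 4 <= h / 2: the widened tube stays in its cell.\<close>

lemma tower_dichotomy:
  fixes p
  defines "h \<equiv> level_of (p$2)"
  assumes "p \<in> tower"
  obtains (flat) "stretch (p$2) = 0" "stretch' (p$2) = 0"
  | (gap) i where "0 < h" "h \<le> 1/2" "\<bar>p$1 - centre h i\<bar> < h\<^sup>2 / 2" "shift p = p$1 - centre h i"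
      "\<bar>horiz p - centre h i\<bar> < h / 2" "h / 2 \<le> centre h i" "centre h i \<le> 1 - h / 2"
proof -
  note h = h_def
  note y = tower_coords(3,4)[OF assms(2)]
  obtain j where j: "j \<ge> 1" "level j \<le> p$2" "p$2 < 2 * level j" using ex_level[OF y] .
  have hj: "h = level j" unfolding h by (rule level_of_eq[OF j(2,3)])
  have st: "stretch (p$2) = bump h (p$2)" "stretch' (p$2) = bump' h (p$2)"
    by (simp_all add: stretch_def stretch'_def h)
  have hb: "0 < h" "h \<le> 1/2" "h\<^sup>2 > 0" "h\<^sup>2 \<le> h / 2"
    unfolding hj using level_bounds[OF j(1)] level_square[OF j(1)] by blast+
  show thesis
  proof (cases "p$2 \<le> 2 * h - h\<^sup>2")
    case True
    then obtain i where i: "i < 2^j" "\<bar>p$1 - centre h i\<bar> < h\<^sup>2 / 2"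
      using tower_gap[OF j(1,2) _ assms(2)] unfolding hj by blast
    have "\<bar>p$1 - centre h i\<bar> < h / 2" using i(2) hb by linarith
    then have shift: "shift p = p$1 - centre h i" by (simp add: shift_def offset_eq flip: h)
    have "horiz p - centre h i = (p$1 - centre h i) * (1 + bump h (p$2))"
      by (simp add: horiz_def shift st algebra_simps)
    then have "\<bar>horiz p - centre h i\<bar> = \<bar>p$1 - centre h i\<bar> * (1 + bump h (p$2))"
      using bump_nonneg[OF hb(1), of "p$2"] by (simp add: abs_mult)
    also have "\<dots> < h\<^sup>2 / 2 * (1 + 1 / (2 * h))"
      using i(2) bump_bounds(1)[OF hb(1), of "p$2"] bump_nonneg[OF hb(1), of "p$2"]
      by (intro mult_less_le_imp_less) auto
    also have "\<dots> = h\<^sup>2 / 2 + h / 4" using hb(1) by (simp add: distrib_left power2_eq_square)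
    also have "\<dots> \<le> h / 2" using hb by linarith
    finally show thesis
      using gap[OF hb(1,2) i(2) shift] centre_bounds[OF i(1)] hj by simp
  next
    case False
    then show thesis using flat bump_eq_0[of "p$2" h] st by simp
  qed
qed

lemma shift_stretch'_le:
  assumes "p \<in> tower"
  shows "\<bar>shift p * stretch' (p$2)\<bar> \<le> 2"
  using assms
proof (cases rule: tower_dichotomy)
  case (gap i)
  let ?h = "level_of (p$2)"
  have "\<bar>shift p * stretch' (p$2)\<bar> \<le> ?h\<^sup>2 / 2 * (4 / ?h\<^sup>2)"
    unfolding abs_mult using gap bump_bounds(2)[OF gap(1), of "p$2"]
    by (intro mult_mono) (auto simp: stretch'_def)
  also have "\<dots> = 2" using gap(1) by simp
  finally show ?thesis .
qed simp

lemma horiz_bounds: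
  assumes "p \<in> tower"
  shows "0 < horiz p" "horiz p < 1"
proof -
  have "0 < horiz p \<and> horiz p < 1"
    using assms
  proof (cases rule: tower_dichotomy)
    case flat
    then show ?thesis using tower_coords[OF assms] by (simp add: horiz_def)
  next
    case (gap i)
    then show ?thesis by linarith
  qed
  then show "0 < horiz p" "horiz p < 1" by auto
qed

text \<open>The second coordinate determines the height. At that height widened tubes occupy
  disjoint cells, and within one tube \<open>horiz\<close> is affine with slope 1 +
  \<open>stretch\<close> > 0.\<close>

lemma inj_on_unfold_map: "inj_on unfold_map tower"
proof (rule inj_onI)
  fix p q assume p: "p \<in> tower" and q: "q \<in> tower" and eq: "unfold_map p = unfold_map q"
  have "height (p$2) = height (q$2)"
    using arg_cong[OF eq, of "\<lambda>v. v$2"] by (simp add: unfold_map_def)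
  then have y: "p$2 = q$2" using height_inj tower_coords p q by blast
  have "height (p$2) * horiz p = height (q$2) * horiz q"
    using arg_cong[OF eq, of "\<lambda>v. v$1"] by (simp add: unfold_map_def)
  then have X: "horiz p = horiz q" using y height_pos[of "q$2"] by simp
  define h where "h = level_of (p$2)"
  have h: "h = level_of (q$2)" by (simp add: h_def y)
  have "p$1 = q$1"
    using p
  proof (cases rule: tower_dichotomy)
    case flat
    then show ?thesis using X y by (simp add: horiz_def)
  next
    case (gap i)
    note gi = gap[folded h_def]
    show ?thesis
      using q
    proof (cases rule: tower_dichotomy)
      case flat
      then show ?thesis using X y by (simp add: horiz_def)
    next
      case (gap k)
      note gk = gap[folded h]
      have "\<bar>centre h i - centre h k\<bar> < h" using gi gk X by linarith
      then have "i = k" using centre_diff gk(1) by blast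
      then have "(p$1 - q$1) * (1 + stretch (q$2)) = 0"
        using X gi gk y by (simp add: horiz_def algebra_simps)
      moreover have "1 + stretch (q$2) > 0" using stretch_nonneg[of "q$2"] by simp
      ultimately show ?thesis by simp
    qed
  qed
  then show "p = q" using y by (simp add: vec_eq_iff forall_2)
qed

section \<open>Derivative of the unfolding map\<close>

definition dilation :: "real^2 \<Rightarrow> real" where
  "dilation p = height (p$2) * (1 + stretch (p$2))"

text \<open>The upper right entry of the Jacobian matrix of \<open>unfold_map\<close>, divided by
  \<open>dilation\<close>.\<close>

definition skew :: "real^2 \<Rightarrow> real" where
  "skew p = horiz p + shift p * stretch' (p$2) / (1 + stretch (p$2))"

lemma has_derivative_vector_2:
  fixes f g :: "'a::real_normed_vector \<Rightarrow> real"
  assumes "(f has_derivative f') (at x)" "(g has_derivative g') (at x)"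
  shows "((\<lambda>x. vector [f x, g x] :: real^2) has_derivative (\<lambda>v. vector [f' v, g' v])) (at x)"
proof -
  have vec: "(vector [a, b] :: real^2) = a *\<^sub>R axis 1 1 + b *\<^sub>R axis 2 1" for a b :: real
    by (simp add: vec_eq_iff forall_2 axis_def)
  show ?thesis unfolding vec by (intro derivative_intros assms)
qed

lemma has_derivative_nth_compose:
  fixes \<phi> :: "real \<Rightarrow> real"
  assumes "(\<phi> has_real_derivative D) (at (p$i))"
  shows "((\<lambda>q. \<phi> (q$i)) has_derivative (\<lambda>v. D * v$i)) (at p)"
  using has_derivative_compose[OF bounded_linear_imp_has_derivative[OF bounded_linear_vec_nth]
      assms[unfolded has_field_derivative_def]]
  by (simp add: o_def)

text \<open>With the locally constant centre c the map is explicit. Both diagonal entries are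
  \<open>height\<close> times 1 + \<open>stretch\<close>, one from the widening and one from the
  chain rule for \<open>height\<close>.\<close>

lemma has_derivative_unfold_map:
  assumes "p \<in> tower"
  shows "(unfold_map has_derivative shear (dilation p) (- skew p)) (at p)"
proof -
  obtain S c where S: "open S" "p \<in> S" "S \<subseteq> tower"
    and "\<forall>q\<in>S. \<forall>\<psi>\<in>{stretch, stretch'}. shift q * \<psi> (q$2) = (q$1 - c) * \<psi> (q$2)"
    by (rule tower_local[OF assms])
  then have eq: "shift q * \<psi> (q$2) = (q$1 - c) * \<psi> (q$2)"
    if "q \<in> S" "\<psi> \<in> {stretch, stretch'}" for q \<psi>
    using that by blast
  define H s where "H = height (p$2)" and "s = stretch (p$2)"
  have y: "0 < p$2" "p$2 < 1" "p$2 < 2" using tower_coords[OF assms] by auto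
  have H: "((\<lambda>q. height (q$2)) has_derivative (\<lambda>v. H * (1 + s) * v$2)) (at p)"
    unfolding H_def s_def by (intro has_derivative_nth_compose DERIV_height y)
  have St: "((\<lambda>q. stretch (q$2)) has_derivative (\<lambda>v. stretch' (p$2) * v$2)) (at p)"
    by (intro has_derivative_nth_compose DERIV_stretch y)
  have x: "((\<lambda>q::real^2. q$1) has_derivative (\<lambda>v. v$1)) (at p)"
    by (rule bounded_linear_imp_has_derivative[OF bounded_linear_vec_nth])
  have "((\<lambda>q. height (q$2) * (q$1 + (q$1 - c) * stretch (q$2))) has_derivative
      (\<lambda>v. H * (v$1 + ((p$1 - c) * (stretch' (p$2) * v$2) + (v$1 - 0) * s))
        + H * (1 + s) * v$2 * (p$1 + (p$1 - c) * s))) (at p)"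
    unfolding H_def s_def
    by (intro has_derivative_mult has_derivative_add has_derivative_diff has_derivative_const
        x St H[unfolded H_def s_def])
  from has_derivative_vector_2[OF this H]
  have "(unfold_map has_derivative (\<lambda>v. vector [H * (v$1 + ((p$1 - c) * (stretch' (p$2) * v$2) + (v$1 - 0) * s))
        + H * (1 + s) * v$2 * (p$1 + (p$1 - c) * s), H * (1 + s) * v$2])) (at p)"
  proof (rule has_derivative_transform_within_open[OF _ S(1,2)])
    fix q assume "q \<in> S"
    from eq[OF this, of stretch]
    show "vector [height (q$2) * (q$1 + (q$1 - c) * stretch (q$2)), height (q$2)] = unfold_map q"
      by (auto simp: unfold_map_def horiz_def)
  qed
  also have "(\<lambda>v. vector [H * (v$1 + ((p$1 - c) * (stretch' (p$2) * v$2) + (v$1 - 0) * s))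
        + H * (1 + s) * v$2 * (p$1 + (p$1 - c) * s), H * (1 + s) * v$2]) = shear (dilation p) (- skew p)"
  proof
    fix v :: "real^2"
    have s1: "1 + s \<noteq> 0" using stretch_nonneg[of "p$2"] by (simp add: s_def)
    have skew: "skew p = p$1 + (p$1 - c) * s + (p$1 - c) * stretch' (p$2) / (1 + s)"
      using eq[OF S(2), of stretch] eq[OF S(2), of stretch'] by (auto simp: skew_def horiz_def s_def)
    have "(1 + s) * skew p = (1 + s) * (p$1 + (p$1 - c) * s) + (p$1 - c) * stretch' (p$2)"
      using s1 by (simp add: skew distrib_left[of "1 + s"])
    then have "H * ((1 + s) * skew p) * v$2
        = H * ((1 + s) * (p$1 + (p$1 - c) * s) + (p$1 - c) * stretch' (p$2)) * v$2" by simp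
    then show "vector [H * (v$1 + ((p$1 - c) * (stretch' (p$2) * v$2) + (v$1 - 0) * s))
        + H * (1 + s) * v$2 * (p$1 + (p$1 - c) * s), H * (1 + s) * v$2] = shear (dilation p) (- skew p) v"
      unfolding vec_eq_iff forall_2 shear_nth vector_2 dilation_def H_def[symmetric] s_def[symmetric]
      by (simp add: algebra_simps)
  qed
  finally show ?thesis .
qed

lemma continuous_on_shift_mult:
  assumes \<psi>: "\<psi> \<in> {stretch, stretch'}"
  shows "continuous_on tower (\<lambda>q. shift q * \<psi> (q$2))"
proof (intro continuous_at_imp_continuous_on ballI)
  fix p assume p: "p \<in> tower"
  obtain S c where S: "open S" "p \<in> S"
    and "\<forall>q\<in>S. \<forall>\<psi>\<in>{stretch, stretch'}. shift q * \<psi> (q$2) = (q$1 - c) * \<psi> (q$2)"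
    by (rule tower_local[OF p])
  then have eq: "shift q * \<psi> (q$2) = (q$1 - c) * \<psi> (q$2)" if "q \<in> S" for q
    using that \<psi> by blast
  have "0 < p$2" "p$2 < 2" using tower_coords[OF p] by auto
  then have "isCont stretch (p$2)" "isCont stretch' (p$2)"
    by (simp_all add: DERIV_isCont[OF DERIV_stretch(1)] DERIV_stretch(2))
  then have "isCont \<psi> (p$2)" using \<psi> by blast
  then have "isCont (\<lambda>q. \<psi> (q$2)) p" by (rule isCont_o2[OF isCont_vec_nth[OF continuous_ident]])
  then have cont: "isCont (\<lambda>q. (q$1 - c) * \<psi> (q$2)) p"
    by (intro isCont_mult isCont_diff isCont_vec_nth[OF continuous_ident] continuous_const)
  have "\<forall>\<^sub>F q in nhds p. (q$1 - c) * \<psi> (q$2) = shift q * \<psi> (q$2)"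
    using eventually_nhds_in_open[OF S] by eventually_elim (simp add: eq)
  from isCont_cong[OF this] cont show "isCont (\<lambda>q. shift q * \<psi> (q$2)) p" by blast
qed

lemma continuous_on_tower_nth:
  assumes "\<And>y. 0 < y \<Longrightarrow> y < 1 \<Longrightarrow> isCont \<psi> y"
  shows "continuous_on tower (\<lambda>q. \<psi> (q$2))"
proof (intro continuous_at_imp_continuous_on ballI)
  fix p assume "p \<in> tower"
  then have "isCont \<psi> (p$2)" by (intro assms tower_coords)
  then show "isCont (\<lambda>q. \<psi> (q$2)) p" by (rule isCont_o2[OF isCont_vec_nth[OF continuous_ident]])
qed

lemma continuous_on_dilation: "continuous_on tower dilation"
  unfolding dilation_def[abs_def]
  by (intro continuous_on_mult continuous_on_add continuous_on_const continuous_on_tower_nth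
      DERIV_isCont[OF DERIV_height] DERIV_isCont[OF DERIV_stretch(1)]) simp_all

lemma continuous_on_skew: "continuous_on tower skew"
proof -
  have "continuous_on tower (\<lambda>q. stretch (q$2))"
    by (intro continuous_on_tower_nth DERIV_isCont[OF DERIV_stretch(1)]) simp_all
  moreover have "1 + stretch (q$2) \<noteq> 0" for q :: "real^2" using stretch_nonneg[of "q$2"] by simp
  ultimately show ?thesis
    unfolding skew_def[abs_def] horiz_def[abs_def]
    by (intro continuous_on_add continuous_on_divide continuous_on_shift_mult continuous_on_component
        continuous_on_id continuous_on_const) simp_all
qed

lemma dilation_pos: "dilation p > 0"
  using stretch_nonneg[of "p$2"] by (simp add: dilation_def add_pos_nonneg)

lemma abs_skew_le: "p \<in> tower \<Longrightarrow> \<bar>skew p\<bar> \<le> 3"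
proof -
  assume p: "p \<in> tower"
  have s: "1 \<le> 1 + stretch (p$2)" using stretch_nonneg[of "p$2"] by simp
  have "\<bar>shift p * stretch' (p$2) / (1 + stretch (p$2))\<bar> \<le> \<bar>shift p * stretch' (p$2)\<bar> / 1"
    unfolding abs_divide using s by (intro divide_left_mono) auto
  also have "\<dots> \<le> 2" using shift_stretch'_le[OF p] by simp
  finally show "\<bar>skew p\<bar> \<le> 3" using horiz_bounds[OF p] unfolding skew_def by linarith
qed

section \<open>The inverse map\<close>

lemma shear_inverse: "\<alpha> \<noteq> 0 \<Longrightarrow> shear \<alpha> (- \<beta>) \<circ> shear (1 / \<alpha>) \<beta> = id"
  by (rule ext) (simp add: vec_eq_iff forall_2 field_simps)

text \<open>The derivative of g is the inverse shear, whose coefficient \<open>skew\<close> is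
  bounded by 3, whence 11 = 3^2 + 2. The image is open by invariance of domain.\<close>

lemma quasiconformal_unfold_map_inverse:
  assumes hom: "homeomorphism tower (unfold_map ` tower) unfold_map g"
  shows "K_quasiconformal 11 (unfold_map ` tower) tower g"
proof -
  let ?\<Omega> = "unfold_map ` tower"
  have cont: "continuous_on tower unfold_map" using hom by (simp add: homeomorphism_def)
  have g_cont: "continuous_on ?\<Omega> g" and g_img: "g ` ?\<Omega> = tower"
    and gf: "\<And>p. p \<in> tower \<Longrightarrow> g (unfold_map p) = p"
    using hom by (auto simp: homeomorphism_def)
  have "is_domain ?\<Omega>"
    using is_domain_tower invariance_of_domain[OF cont open_tower inj_on_unfold_map]
      connected_continuous_image[OF cont] by (auto simp: is_domain_def)
  moreover have "(g has_derivative shear (1 / dilation (g z)) (skew (g z))) (at z)" if "z \<in> ?\<Omega>" for z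
  proof -
    from that obtain p where p: "p \<in> tower" "z = unfold_map p" by blast
    have "shear (dilation p) (- skew p) \<circ> shear (1 / dilation p) (skew p) = id"
      by (rule shear_inverse) (use dilation_pos[of p] in simp)
    from has_derivative_inverse_on[where f' = "\<lambda>p. shear (dilation p) (- skew p)"
        and g' = "\<lambda>p. shear (1 / dilation p) (skew p)", OF open_tower has_derivative_unfold_map gf this p(1)]
    show ?thesis using p gf[OF p(1)] by simp
  qed
  moreover have "continuous_on ?\<Omega> (\<lambda>z. dilation (g z))"
    by (rule continuous_on_compose2[OF continuous_on_dilation g_cont]) (simp add: g_img)
  then have "continuous_on ?\<Omega> (\<lambda>z. 1 / dilation (g z))"
    by (rule continuous_on_divide[OF continuous_on_const]) (simp add: dilation_pos[THEN less_imp_neq, THEN not_sym])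
  moreover have "continuous_on ?\<Omega> (\<lambda>z. skew (g z))"
    by (rule continuous_on_compose2[OF continuous_on_skew g_cont]) (simp add: g_img)
  moreover have "\<bar>skew (g z)\<bar> \<le> 3" if "z \<in> ?\<Omega>" for z
    using that g_img by (intro abs_skew_le) auto
  ultimately have "K_quasiconformal (3\<^sup>2 + 2) ?\<Omega> tower g"
    using is_domain_tower homeomorphism_symD[OF hom] dilation_pos
    by (intro K_quasiconformal_shear[where \<alpha> = "\<lambda>z. 1 / dilation (g z)" and \<beta> = "\<lambda>z. skew (g z)"])
       (simp_all add: less_imp_le)
  then show ?thesis by simp
qed

section \<open>Failure of uniform continuity\<close>

lemma internal_dist_le_segment:
  assumes "closed_segment x y \<subseteq> G"
  shows "internal_dist G x y \<le> ennreal (dist x y)"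
proof -
  have "linepath x y \<in> curves_joining G x y"
    using assms by (simp add: curves_joining_def)
  then have "internal_dist G x y \<le> curve_length (linepath x y) 0 1"
    unfolding internal_dist_def by (rule INF_lower)
  also have "\<dots> \<le> ennreal (dist x y * (1 - 0))"
  proof (rule curve_length_le_lipschitz)
    fix s t :: real
    have "linepath x y s - linepath x y t = (t - s) *\<^sub>R (x - y)"
      by (simp add: linepath_def algebra_simps)
    then show "dist (linepath x y s) (linepath x y t) \<le> dist x y * \<bar>s - t\<bar>"
      by (simp add: dist_norm abs_minus_commute)
  qed auto
  finally show ?thesis by simp
qed

text \<open>On the midline of layer j the map is t |-> r (t, 1) with r = \<open>height y\<close>
  arbitrarily small. The points t = 1/4 and t = 3/4 are 1/2 apart, while their images are joined by
  a segment of length r / 2 inside the image of the layer.\<close>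

lemma not_uniformly_continuous_unfold_map_inverse:
  assumes gf: "\<And>p. p \<in> tower \<Longrightarrow> g (unfold_map p) = p"
  shows "\<not> uniformly_continuous_internal (unfold_map ` tower) g"
proof
  assume "uniformly_continuous_internal (unfold_map ` tower) g"
  then obtain \<delta> where \<delta>: "\<delta> > 0"
    and uc: "\<And>x y. x \<in> unfold_map ` tower \<Longrightarrow> y \<in> unfold_map ` tower \<Longrightarrow>
      internal_dist (unfold_map ` tower) x y < ennreal \<delta> \<Longrightarrow> dist (g x) (g y) < 1/2"
    unfolding uniformly_continuous_internal_def by (meson half_gt_zero zero_less_one)
  obtain j where j: "j \<ge> 1" "height (2 * level j - (level j)\<^sup>2 / 2) < \<delta>"
    using height_small[OF \<delta>] .
  define y where "y = 2 * level j - (level j)\<^sup>2 / 2"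
  define r where "r = height y"
  have r: "0 < r" "r < \<delta>" using j(2) by (simp_all add: r_def y_def)
  define w where "w t = (vector [t, y] :: real^2)" for t
  have lay: "w t \<in> layer (level j)" if "1/4 \<le> t" "t \<le> 3/4" for t
    using that level_square[OF j(1)] by (simp add: mem_layer w_def y_def)
  then have tow: "w t \<in> tower" if "1/4 \<le> t" "t \<le> 3/4" for t
    using that layer_subset_tower[OF j(1)] by blast
  have "level j - (level j)\<^sup>2 / 4 < y" "y < 2 * level j" "2 * level j - (level j)\<^sup>2 \<le> y"
    unfolding y_def using level_square[OF j(1)] level_pos[of j] by linarith+
  then have "stretch y = 0" using stretch_eq_bump(1)[of j y] bump_eq_0[of y "level j"] by simp
  then have um: "unfold_map (w t) = vector [r * t, r]" for t
    by (simp add: unfold_map_def w_def horiz_def r_def)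
  have "closed_segment (unfold_map (w (1/4))) (unfold_map (w (3/4))) \<subseteq> unfold_map ` tower"
  proof
    fix z assume "z \<in> closed_segment (unfold_map (w (1/4))) (unfold_map (w (3/4)))"
    then obtain u where u: "0 \<le> u" "u \<le> 1"
      and z: "z = (1 - u) *\<^sub>R unfold_map (w (1/4)) + u *\<^sub>R unfold_map (w (3/4))"
      by (auto simp: closed_segment_def)
    have "z = unfold_map (w (1/4 + u / 2))"
      unfolding z um by (simp add: vec_eq_iff forall_2 algebra_simps)
    moreover have "w (1/4 + u / 2) \<in> tower" using u by (intro tow) auto
    ultimately show "z \<in> unfold_map ` tower" by blast
  qed
  then have "internal_dist (unfold_map ` tower) (unfold_map (w (1/4))) (unfold_map (w (3/4)))
      \<le> ennreal (dist (unfold_map (w (1/4))) (unfold_map (w (3/4))))"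
    by (rule internal_dist_le_segment)
  also have "dist (unfold_map (w (1/4))) (unfold_map (w (3/4))) = r / 2"
    using r by (simp add: um dist_norm norm_vec_def L2_set_def sum_2 flip: right_diff_distrib)
  also have "ennreal (r / 2) < ennreal \<delta>" using r by (simp add: ennreal_less_iff)
  finally have "dist (g (unfold_map (w (1/4)))) (g (unfold_map (w (3/4)))) < 1/2"
    using tow by (intro uc) auto
  moreover have "dist (w (1/4)) (w (3/4)) = 1/2"
    by (simp add: w_def dist_norm norm_vec_def L2_set_def sum_2)
  ultimately show False using gf tow by simp
qed

theorem corollary1p3:
  shows "\<exists>(\<Omega> :: (real^2) set) (x\<^sub>0 :: real^2) (C :: real).
           is_domain \<Omega> \<and> bounded \<Omega> \<and> x\<^sub>0 \<in> \<Omega> \<and> C > 0 \<and>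
           (\<forall>x\<in>\<Omega>. quasihyperbolic_dist \<Omega> x x\<^sub>0
                      \<le> ennreal (C * infdist x (frontier \<Omega>) powr (- (1/2)))) \<and>
           (\<exists>(\<Omega>' :: (real^2) set) (f :: real^2 \<Rightarrow> real^2).
              is_domain \<Omega>' \<and> quasiconformal \<Omega>' \<Omega> f \<and>
              \<not> uniformly_continuous_internal \<Omega>' f)"
proof -
  have "continuous_on tower unfold_map"
    using has_derivative_unfold_map has_derivative_continuous
    by (blast intro: continuous_at_imp_continuous_on)
  then obtain g where hom: "homeomorphism tower (unfold_map ` tower) unfold_map g"
    using invariance_of_domain_homeomorphism[OF open_tower _ _ inj_on_unfold_map] by blast
  then have K: "K_quasiconformal 11 (unfold_map ` tower) tower g"
    by (rule quasiconformal_unfold_map_inverse)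
  then have "quasiconformal (unfold_map ` tower) tower g"
    unfolding quasiconformal_def by (intro exI[of _ 11]) simp
  moreover have "is_domain (unfold_map ` tower)" using K by (simp add: K_quasiconformal_def)
  moreover have "\<not> uniformly_continuous_internal (unfold_map ` tower) g"
    using hom by (intro not_uniformly_continuous_unfold_map_inverse) (simp add: homeomorphism_def)
  ultimately show ?thesis
    using is_domain_tower bounded_tower basepoint_in_tower quasihyperbolic_dist_tower
    by (intro exI[of _ tower] exI[of _ basepoint] exI[of _ "50::real"] conjI ballI
        exI[of _ "unfold_map ` tower"] exI[of _ g]) simp_all
qed

end
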